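(* Let $\Lambda_0$ be a (finite or countable) biconnected graph. Let $H\le\mathrm{Aut}(\Lambda_0)$, let $\{Q_j : j\in\mathbb{J}\}$ be the set of orbits of $H$ on $V\Lambda_0$, and let $\{R_k : k\in\mathbb{K}\}$ be a partition of $V\Lambda_0$ such that each $Q_j$ is contained in some $R_k$. For each $k\in\mathbb{K}$ let $\mu_k:\mathbb{J}\to\mathbb{N}\cup\{0,\aleph_0\}$ be a function with $\mu_k(j)>0$ if and only if $Q_j\subseteq R_k$, and suppose $\sum_{j\in\mathbb{J}}\mu_k(j)\ge 2$ for at least one $k\in\mathbb{K}$. Then there exists, unique up to isomorphism, a lobe-transitive graph $\Gamma$ of connectivity $1$ together with isomorphisms $\sigma_\Lambda:\Lambda_0\to\Lambda$ for every lobe $\Lambda\in\mathscr{L}(\Gamma)$ such that for each vertex $v\in V\Gamma$ there is $k\in\mathbb{K}$ with $$\mu_k(j)=\bigl|\{\Lambda\in\mathscr{L}(\Gamma): \sigma_\Lambda^{-1}(v)\in Q_j\}\bigr|\quad\text{for all } j\in\mathbb{J}.$$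
   Context: All graphs are simple, connected, and finite or countably infinite. For edges $e_1,e_2$ of a graph $\Gamma$ write $e_1\cong e_2$ if $e_1=e_2$ or they lie on a common cycle; a lobe of $\Gamma$ is the subgraph induced by an equivalence class of this relation (a cut-edge with its ends, or a maximal biconnected subgraph). $\mathscr{L}(\Gamma)$ is the set of lobes. A connected graph other than $K_2$ has connectivity $1$ iff some vertex lies in at least two lobes. $\Gamma$ is lobe-transitive if $\mathrm{Aut}(\Gamma)$ acts transitively on $\mathscr{L}(\Gamma)$. $\mathbb{N}$ denotes the positive integers. *)

theory Defs
  imports Main "HOL-Library.Extended_Nat" "HOL-Library.Countable_Set"
begin

definition simple_graph :: "'v set \<Rightarrow> ('v \<Rightarrow> 'v \<Rightarrow> bool) \<Rightarrow> bool" where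
  "simple_graph V E \<longleftrightarrow> (\<forall>x y. E x y \<longrightarrow> x \<in> V \<and> y \<in> V \<and> E y x \<and> x \<noteq> y)"

definition connected_in :: "'v set \<Rightarrow> ('v \<Rightarrow> 'v \<Rightarrow> bool) \<Rightarrow> bool" where
  "connected_in S E \<longleftrightarrow> S \<noteq> {} \<and>
     (\<forall>x\<in>S. \<forall>y\<in>S. (\<lambda>u w. E u w \<and> u \<in> S \<and> w \<in> S)\<^sup>*\<^sup>* x y)"

text \<open>Biconnected: connected, at least two vertices, no cut vertex (so K2 is biconnected).\<close>
definition biconnected :: "'v set \<Rightarrow> ('v \<Rightarrow> 'v \<Rightarrow> bool) \<Rightarrow> bool" where
  "biconnected V E \<longleftrightarrow> connected_in V E \<and> (\<exists>x\<in>V. \<exists>y\<in>V. x \<noteq> y) \<and>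
     (\<forall>v\<in>V. connected_in (V - {v}) E)"

definition connectivity_one :: "'v set \<Rightarrow> ('v \<Rightarrow> 'v \<Rightarrow> bool) \<Rightarrow> bool" where
  "connectivity_one V E \<longleftrightarrow> connected_in V E \<and>
     ((finite V \<and> card V = 2) \<or> (\<exists>v\<in>V. V - {v} \<noteq> {} \<and> \<not> connected_in (V - {v}) E))"

definition graph_iso :: "'a set \<Rightarrow> ('a \<Rightarrow> 'a \<Rightarrow> bool) \<Rightarrow> 'b set \<Rightarrow> ('b \<Rightarrow> 'b \<Rightarrow> bool)
    \<Rightarrow> ('a \<Rightarrow> 'b) \<Rightarrow> bool" where
  "graph_iso V E V' E' f \<longleftrightarrow> bij_betw f V V' \<and> (\<forall>x\<in>V. \<forall>y\<in>V. E x y \<longleftrightarrow> E' (f x) (f y))"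

text \<open>Automorphisms, normalised to be the identity outside V so that they form a group under composition.\<close>
definition Aut :: "'v set \<Rightarrow> ('v \<Rightarrow> 'v \<Rightarrow> bool) \<Rightarrow> ('v \<Rightarrow> 'v) set" where
  "Aut V E = {f. graph_iso V E V E f \<and> (\<forall>x. x \<notin> V \<longrightarrow> f x = x)}"

definition aut_subgroup :: "('v \<Rightarrow> 'v) set \<Rightarrow> 'v set \<Rightarrow> ('v \<Rightarrow> 'v \<Rightarrow> bool) \<Rightarrow> bool" where
  "aut_subgroup H V E \<longleftrightarrow> H \<subseteq> Aut V E \<and> id \<in> H \<and> (\<forall>g\<in>H. \<forall>h\<in>H. g \<circ> h \<in> H) \<and>
     (\<forall>h\<in>H. \<exists>h'\<in>H. h' \<circ> h = id)"

definition orbits :: "('v \<Rightarrow> 'v) set \<Rightarrow> 'v set \<Rightarrow> 'v set set" where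
  "orbits H V = {(\<lambda>h. h x) ` H | x. x \<in> V}"

definition edges :: "('v \<Rightarrow> 'v \<Rightarrow> bool) \<Rightarrow> 'v set set" where
  "edges E = {{u, w} | u w. E u w}"

definition is_cycle :: "('v \<Rightarrow> 'v \<Rightarrow> bool) \<Rightarrow> 'v list \<Rightarrow> bool" where
  "is_cycle E cs \<longleftrightarrow> length cs \<ge> 3 \<and> distinct cs \<and>
     (\<forall>i < length cs. E (cs ! i) (cs ! ((i + 1) mod length cs)))"

definition cycle_edges :: "'v list \<Rightarrow> 'v set set" where
  "cycle_edges cs = {{cs ! i, cs ! ((i + 1) mod length cs)} | i. i < length cs}"

definition lobe_rel :: "('v \<Rightarrow> 'v \<Rightarrow> bool) \<Rightarrow> 'v set \<Rightarrow> 'v set \<Rightarrow> bool" where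
  "lobe_rel E e1 e2 \<longleftrightarrow> e1 = e2 \<or>
     (\<exists>cs. is_cycle E cs \<and> e1 \<in> cycle_edges cs \<and> e2 \<in> cycle_edges cs)"

text \<open>A lobe is represented by its equivalence class of edges; its vertex set is the union of
  the class and its adjacency is membership in the class.\<close>
definition lobes :: "('v \<Rightarrow> 'v \<Rightarrow> bool) \<Rightarrow> 'v set set set" where
  "lobes E = {{e' \<in> edges E. lobe_rel E e e'} | e. e \<in> edges E}"

definition lobe_verts :: "'v set set \<Rightarrow> 'v set" where
  "lobe_verts C = \<Union>C"

definition lobe_adj :: "'v set set \<Rightarrow> 'v \<Rightarrow> 'v \<Rightarrow> bool" where
  "lobe_adj C x y \<longleftrightarrow> {x, y} \<in> C"

definition lobe_transitive :: "'v set \<Rightarrow> ('v \<Rightarrow> 'v \<Rightarrow> bool) \<Rightarrow> bool" where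
  "lobe_transitive V E \<longleftrightarrow>
     (\<forall>C1\<in>lobes E. \<forall>C2\<in>lobes E. \<exists>g\<in>Aut V E. (\<lambda>e. g ` e) ` C1 = C2)"

text \<open>Cardinality in \<open>\<nat> \<union> {0, \<aleph>\<^sub>0}\<close>; \<open>\<infinity>\<close> stands for \<open>\<aleph>\<^sub>0\<close> (all sets involved are countable).\<close>
definition ecard :: "'v set \<Rightarrow> enat" where
  "ecard S = (if finite S then enat (card S) else \<infinity>)"

definition realizes :: "'a set \<Rightarrow> ('a \<Rightarrow> 'a \<Rightarrow> bool) \<Rightarrow> 'j set \<Rightarrow> ('j \<Rightarrow> 'a set) \<Rightarrow> 'k set
    \<Rightarrow> ('k \<Rightarrow> 'j \<Rightarrow> enat) \<Rightarrow> 'v set \<Rightarrow> ('v \<Rightarrow> 'v \<Rightarrow> bool) \<Rightarrow> ('v set set \<Rightarrow> 'a \<Rightarrow> 'v) \<Rightarrow> bool" where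
  "realizes V0 E0 J Q K \<mu> V E \<sigma> \<longleftrightarrow>
     simple_graph V E \<and> countable V \<and> lobe_transitive V E \<and> connectivity_one V E \<and>
     (\<forall>C\<in>lobes E. graph_iso V0 E0 (lobe_verts C) (lobe_adj C) (\<sigma> C)) \<and>
     (\<forall>v\<in>V. \<exists>k\<in>K. \<forall>j\<in>J. \<mu> k j = ecard {C \<in> lobes E. v \<in> \<sigma> C ` Q j})"

end

theory Submission
  imports Defs
begin

text \<open>Gluing copies of \<open>\<Lambda>\<^sub>0\<close> along vertices in the only way that the numbers \<open>\<mu>\<^sub>k(j)\<close> allow
  gives a rooted tree of copies. A cycle cannot leave a branch of this tree and return, and any
  two edges of a biconnected graph lie on a common cycle, so the lobes are exactly the copies.
  Any graph that realizes the data is covered by this tree, starting from an arbitrary lobe as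
  root: the lobes at a vertex are matched with slots by counting, and an element of \<open>H\<close> adjusts
  \<open>\<sigma>\<close> at the vertex of attachment. The covering map is injective because distinct lobes at a
  vertex \<open>v\<close> lie in distinct components after removal of \<open>v\<close>. This gives uniqueness, and
  applied to the tree itself, with two choices of the root lobe, lobe-transitivity.\<close>

section \<open>Paths and cycles\<close>

text \<open>The lists name every lobe relative to a root, while the theorem wants all lobes to look
  alike: seen from a child, its parent fills an ordinary slot, so a change of root renames every
  list. This is why lobe-transitivity is drawn from uniqueness and not from symmetries of the lists.
  Slots know positions only up to \<open>H\<close>. Hence a lobe of the tree is mapped by
  \<open>\<sigma>\<close> preceded by an element of \<open>H\<close>, and the isomorphism obtained
  need not be compatible with \<open>\<sigma>\<close> itself. Three properties of the numbers keep
  the slots consistent: they are constant on orbits, they are positive for the orbit of the position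
  itself, which leaves a slot for the lobe one comes from, and they agree for all positions that
  meet in one vertex.\<close>

fun path_edges :: "'v list \<Rightarrow> 'v set set" where
  "path_edges (x # y # zs) = insert {x, y} (path_edges (y # zs))"
| "path_edges _ = {}"

lemma path_edges_append:
  "path_edges (xs @ a # ys) = path_edges (xs @ [a]) \<union> path_edges (a # ys)"
  by (induction xs rule: path_edges.induct) auto

lemma path_edges_nth: "path_edges xs = {{xs ! i, xs ! Suc i} | i. Suc i < length xs}"
proof (induction xs rule: path_edges.induct)
  case (1 x y zs)
  have "{{(x # y # zs) ! i, (x # y # zs) ! Suc i} | i. Suc i < length (x # y # zs)}
      = insert {x, y} {{(y # zs) ! i, (y # zs) ! Suc i} | i. Suc i < length (y # zs)}"
    (is "?A = insert _ ?B")
  proof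
    show "?A \<subseteq> insert {x, y} ?B"
    proof
      fix e assume "e \<in> ?A"
      then obtain i where i: "e = {(x # y # zs) ! i, (x # y # zs) ! Suc i}"
        "Suc i < length (x # y # zs)" by blast
      then show "e \<in> insert {x, y} ?B" by (cases i) auto
    qed
    show "insert {x, y} ?B \<subseteq> ?A"
    proof
      fix e assume "e \<in> insert {x, y} ?B"
      then consider "e = {x, y}"
        | i where "e = {(y # zs) ! i, (y # zs) ! Suc i}" "Suc i < length (y # zs)" by blast
      then show "e \<in> ?A"
      proof cases
        case 1
        then show ?thesis by (auto intro!: exI[of _ 0])
      next
        case 2
        then show ?thesis by (auto intro!: exI[of _ "Suc i"])
      qed
    qed
  qed
  with 1 show ?case by simp
qed auto

lemma path_edges_subset: "e \<in> path_edges xs \<Longrightarrow> e \<subseteq> set xs"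
  by (induction xs rule: path_edges.induct) auto

lemma nth_closed_up:
  assumes "i < length cs"
  shows "(cs @ [hd cs]) ! i = cs ! i" "(cs @ [hd cs]) ! Suc i = cs ! ((i + 1) mod length cs)"
proof -
  show "(cs @ [hd cs]) ! i = cs ! i" using assms by (simp add: nth_append)
  show "(cs @ [hd cs]) ! Suc i = cs ! ((i + 1) mod length cs)"
  proof (cases "Suc i < length cs")
    case False
    with assms have "Suc i = length cs" by simp
    with assms show ?thesis by (cases cs) auto
  qed (simp add: nth_append)
qed

text \<open>Appending the first vertex replaces the arithmetic modulo the length by a condition on
  consecutive entries, so cycles can be cut and glued like lists.\<close>

lemma is_cycle_iff:
  "is_cycle E cs \<longleftrightarrow> length cs \<ge> 3 \<and> distinct cs \<and> successively E (cs @ [hd cs])"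
proof -
  have "successively E (cs @ [hd cs]) \<longleftrightarrow> (\<forall>i < length cs. E (cs ! i) (cs ! ((i + 1) mod length cs)))"
    by (simp only: successively_conv_nth length_append list.size)
       (auto simp del: One_nat_def simp: nth_closed_up[simplified])
  then show ?thesis unfolding is_cycle_def by simp
qed

lemma cycle_edges_eq: "cycle_edges cs = path_edges (cs @ [hd cs])"
proof -
  have "{cs ! i, cs ! ((i + 1) mod length cs)} = {(cs @ [hd cs]) ! i, (cs @ [hd cs]) ! Suc i}"
    if "i < length cs" for i
    using nth_closed_up[OF that] by simp
  then show ?thesis
    unfolding cycle_edges_def path_edges_nth by (auto; metis)
qed

lemma cycle_rotate:
  assumes "is_cycle E (xs @ v # ys)"
  shows "is_cycle E (v # ys @ xs)" "cycle_edges (v # ys @ xs) = cycle_edges (xs @ v # ys)"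
proof -
  have "successively E (v # ys @ xs @ [v])" if "xs \<noteq> []"
  proof -
    have *: "successively E (xs @ v # ys @ [hd xs])"
      using assms that by (simp add: is_cycle_iff)
    then have "successively E (v # ys @ [hd xs])" "successively E (xs @ [v])"
      by (auto simp: successively_append_iff)
    with that show ?thesis
      by (cases xs) (auto simp: successively_append_iff successively_Cons hd_append split: if_splits)
  qed
  with assms show "is_cycle E (v # ys @ xs)"
    by (cases "xs = []") (auto simp: is_cycle_iff)
  show "cycle_edges (v # ys @ xs) = cycle_edges (xs @ v # ys)"
  proof (cases xs)
    case (Cons z zs)
    have "path_edges (v # ys @ z # zs @ [v]) = path_edges (v # ys @ [z]) \<union> path_edges (z # zs @ [v])"
      using path_edges_append[of "v # ys" z "zs @ [v]"] by simp
    moreover have "path_edges (z # zs @ v # ys @ [z]) = path_edges (z # zs @ [v]) \<union> path_edges (v # ys @ [z])"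
      using path_edges_append[of "z # zs" v "ys @ [z]"] by simp
    ultimately show ?thesis using Cons by (auto simp: cycle_edges_eq)
  qed simp
qed

lemma cycle_rotate_to:
  assumes "is_cycle E cs" "v \<in> set cs"
  obtains xs where "is_cycle E (v # xs)" "cycle_edges (v # xs) = cycle_edges cs"
    "set (v # xs) = set cs"
proof -
  from assms(2) obtain as bs where cs: "cs = as @ v # bs" by (meson split_list)
  with assms(1) cycle_rotate[of E as v bs] that[of "bs @ as"] show thesis by auto
qed

lemma cycle_of_path:
  assumes "distinct (v # xs)" "successively E xs" "length xs \<ge> 2" "E v (hd xs)" "E (last xs) v"
  shows "is_cycle E (v # xs)" "{v, hd xs} \<in> cycle_edges (v # xs)"
    "{v, last xs} \<in> cycle_edges (v # xs)" "path_edges xs \<subseteq> cycle_edges (v # xs)"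
proof -
  from assms(3) obtain a ys where xs: "xs = a # ys" by (cases xs) auto
  obtain zs b where xs': "xs = zs @ [b]" using assms(3) by (cases xs rule: rev_cases) auto
  have eq: "cycle_edges (v # xs) = insert {v, a} (path_edges xs \<union> {{v, b}})"
  proof -
    have "path_edges (xs @ [v]) = path_edges xs \<union> {{v, b}}"
      using path_edges_append[of zs b "[v]"] xs' by (auto simp: insert_commute)
    then show ?thesis using xs by (simp add: cycle_edges_eq)
  qed
  show "{v, hd xs} \<in> cycle_edges (v # xs)" using eq xs by simp
  show "{v, last xs} \<in> cycle_edges (v # xs)" using eq xs' by simp
  show "path_edges xs \<subseteq> cycle_edges (v # xs)" using eq by auto
  have "successively E (v # xs @ [v])"
    using assms xs' xs by (auto simp: successively_append_iff successively_Cons hd_append)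
  then show "is_cycle E (v # xs)" using assms by (auto simp: is_cycle_iff)
qed

lemma rtranclp_distinct_path:
  assumes "r\<^sup>*\<^sup>* x y"
  obtains xs where "xs \<noteq> []" "hd xs = x" "last xs = y" "distinct xs" "successively r xs"
proof -
  from assms have "\<exists>xs. xs \<noteq> [] \<and> hd xs = x \<and> last xs = y \<and> distinct xs \<and> successively r xs"
  proof (induction rule: converse_rtranclp_induct)
    case base
    show ?case by (rule exI[of _ "[y]"]) simp
  next
    case (step x x')
    then obtain xs where xs: "xs \<noteq> []" "hd xs = x'" "last xs = y" "distinct xs" "successively r xs"
      by blast
    show ?case
    proof (cases "x \<in> set xs")
      case True
      then obtain as bs where "xs = as @ x # bs" by (meson split_list)
      with xs show ?thesis
        by (intro exI[of _ "x # bs"]) (auto simp: successively_append_iff)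
    next
      case False
      with xs step show ?thesis
        by (intro exI[of _ "x # xs"]) (auto simp: successively_Cons)
    qed
  qed
  with that show thesis by blast
qed

text \<open>With a cycle minus one vertex as \<open>T\<close>, this yields an ear that meets
  \<open>T\<close> only at its end.\<close>

lemma rtranclp_first_hit:
  assumes "r\<^sup>*\<^sup>* x y" "y \<in> T"
  obtains xs p where "p \<in> T" "set xs \<inter> T = {}" "distinct (xs @ [p])" "successively r (xs @ [p])"
    "hd (xs @ [p]) = x"
proof -
  obtain ws where ws: "ws \<noteq> []" "hd ws = x" "last ws = y" "distinct ws" "successively r ws"
    using rtranclp_distinct_path[OF assms(1)] .
  then have "\<exists>p\<in>set ws. p \<in> T" using assms(2) last_in_set by blast
  from split_list_first_prop[OF this]
  obtain as p bs where "ws = as @ p # bs" "p \<in> T" "\<forall>q\<in>set as. q \<notin> T" by blast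
  moreover from this ws have "hd (as @ [p]) = x" by (cases as) auto
  ultimately show thesis
    using ws that[of p as]
    by (auto simp: successively_append_iff split: if_splits)
qed

abbreviation avoiding :: "('v \<Rightarrow> 'v \<Rightarrow> bool) \<Rightarrow> 'v \<Rightarrow> 'v \<Rightarrow> 'v \<Rightarrow> bool" where
  "avoiding E v \<equiv> \<lambda>a b. E a b \<and> a \<noteq> v \<and> b \<noteq> v"

section \<open>The lobe relation and biconnected graphs\<close>

lemma lobe_rel_sym: "lobe_rel E e e' \<Longrightarrow> lobe_rel E e' e"
  unfolding lobe_rel_def by blast

text \<open>\<open>successively\<close> holds vacuously for \<open>[v]\<close>, which the bound on
  the length excludes.\<close>

lemma avoiding_path_notin:
  assumes "successively (avoiding E v) xs" "length xs \<ge> 2"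
  shows "v \<notin> set xs"
  using assms
proof (induction xs rule: path_edges.induct)
  case (1 x y zs)
  then show ?case by (cases zs) auto
qed auto

text \<open>The path from \<open>u\<close> to \<open>w\<close> closes up through \<open>v\<close> to
  a cycle that uses both edges.\<close>

lemma lobe_rel_adjacent:
  assumes sg: "simple_graph V E" and vu: "E v u" and vw: "E v w" and uw: "(avoiding E v)\<^sup>*\<^sup>* u w"
  shows "lobe_rel E {v, u} {v, w}"
proof (cases "u = w")
  case False
  obtain xs where xs: "xs \<noteq> []" "hd xs = u" "last xs = w" "distinct xs" "successively (avoiding E v) xs"
    using rtranclp_distinct_path[OF uw] .
  with False have len: "length xs \<ge> 2"
    by (cases xs; cases "tl xs") auto
  have "v \<notin> set xs" using avoiding_path_notin[OF xs(5) len] .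
  moreover have "successively E xs" using xs(5) by (rule successively_mono) auto
  moreover have "E w v" using sg vw unfolding simple_graph_def by blast
  ultimately show ?thesis
    using cycle_of_path[of v xs E] xs vu len unfolding lobe_rel_def by auto
qed (simp add: lobe_rel_def)

text \<open>The path from \<open>u\<close> back to the cycle is an ear; of the two arcs into which its ends cut the
  cycle, the one through \<open>e\<close> closes up with the ear to a cycle.\<close>

lemma lobe_rel_ear:
  assumes sg: "simple_graph V E" and cs: "is_cycle E cs" and e: "e \<in> cycle_edges cs"
    and v: "v \<in> set cs" and vu: "E v u" and p: "p \<in> set cs" "p \<noteq> v"
    and up: "(avoiding E v)\<^sup>*\<^sup>* u p"
  shows "lobe_rel E e {v, u}"
proof -
  have sym: "E a b \<Longrightarrow> E b a" for a b using sg unfolding simple_graph_def by blast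
  have "p \<in> set cs - {v}" using p by simp
  from rtranclp_first_hit[OF up this]
  obtain qs q where q: "q \<in> set cs - {v}" "set qs \<inter> (set cs - {v}) = {}" "distinct (qs @ [q])"
    "successively (avoiding E v) (qs @ [q])" "hd (qs @ [q]) = u" .
  have vqs: "v \<notin> set qs" using avoiding_path_notin[OF q(4)] by (cases qs) auto
  have qsE: "successively E (qs @ [q])" using q(4) by (rule successively_mono) auto
  have "successively (\<lambda>x y. E y x) (qs @ [q])" using qsE by (rule successively_mono) (use sym in blast)
  then have "successively E (rev (qs @ [q]))" by (simp only: successively_rev)
  then have qsE': "successively E (q # rev qs)" by simp
  obtain xs where xs: "is_cycle E (v # xs)" "cycle_edges (v # xs) = cycle_edges cs"
    "set (v # xs) = set cs"
    using cycle_rotate_to[OF cs v] .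
  with q have "q \<in> set xs" by auto
  then obtain ys zs where yz: "xs = ys @ q # zs" by (meson split_list)
  have "cycle_edges cs = path_edges (v # ys @ q # zs @ [v])"
    using xs(2) yz by (simp add: cycle_edges_eq)
  also have "\<dots> = path_edges (v # ys @ [q]) \<union> path_edges (q # zs @ [v])"
    using path_edges_append[of "v # ys" q "zs @ [v]"] by simp
  finally have split: "e \<in> path_edges (v # ys @ [q]) \<or> e \<in> path_edges (q # zs @ [v])"
    using e by blast
  have cyc: "distinct (v # ys @ q # zs)" "successively E (v # ys @ q # zs @ [v])"
    using xs(1) yz by (auto simp: is_cycle_iff)
  have s1: "successively E (v # ys @ [q])" and s2: "successively E (q # zs @ [v])"
    using cyc(2) by (auto simp: successively_append_iff successively_Cons hd_append split: if_splits)
  have dqs: "set qs \<inter> set (v # ys @ q # zs) = {}" "distinct qs"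
    using q(2,3) vqs xs(3) yz by auto
  from split show ?thesis
  proof
    assume e1: "e \<in> path_edges (v # ys @ [q])"
    \<comment> \<open>If arc and ear are both trivial, then \<open>q = u\<close> and
      \<open>e\<close> is \<open>{v, u}\<close> itself; the list below would be too short for a
      cycle.\<close>
    show ?thesis
    proof (cases "ys = [] \<and> qs = []")
      case True
      with e1 q(5) show ?thesis by (auto simp: lobe_rel_def)
    next
      case False
      let ?p = "ys @ q # rev qs"
      have l: "last ?p = u" using q(5) by (cases qs) auto
      have h: "E v (hd ?p)" using s1 by (cases ys) auto
      have s: "successively E ?p"
        using s1 qsE' by (auto simp: successively_append_iff successively_Cons hd_append split: if_splits)
      have d: "distinct (v # ?p)" using cyc(1) dqs by auto
      have "length ?p \<ge> 2" using False by (cases ys; cases qs) auto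
      note c = cycle_of_path[OF d s this h]
      have "e \<in> insert {v, hd ?p} (path_edges ?p)"
        using e1 path_edges_append[of ys q "rev qs"] by (cases ys) auto
      with c l sym[OF vu] show ?thesis unfolding lobe_rel_def by (metis insertE subsetD)
    qed
  next
    assume e2: "e \<in> path_edges (q # zs @ [v])"
    show ?thesis
    proof (cases "zs = [] \<and> qs = []")
      case True
      with e2 q(5) show ?thesis by (auto simp: lobe_rel_def insert_commute)
    next
      case False
      let ?p = "qs @ q # zs"
      have h: "hd ?p = u" using q(5) by (cases qs) auto
      have l: "E (last ?p) v" using s2
        by (cases zs rule: rev_cases) (auto simp: successively_append_iff successively_Cons split: if_splits)
      have s: "successively E ?p"
        using s2 qsE by (auto simp: successively_append_iff successively_Cons hd_append split: if_splits)
      have d: "distinct (v # ?p)" using cyc(1) dqs by auto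
      have "length ?p \<ge> 2" using False by (cases zs; cases qs) auto
      note c = cycle_of_path[OF d s this, unfolded h, OF vu l]
      have "path_edges (q # zs @ [v]) = insert {v, last ?p} (path_edges (q # zs))"
      proof (cases zs rule: rev_cases)
        case (snoc ws b)
        then show ?thesis using path_edges_append[of "q # ws" b "[v]"] by (auto simp: insert_commute)
      qed (auto simp: insert_commute)
      with e2 have "e \<in> insert {v, last ?p} (path_edges ?p)"
        using path_edges_append[of qs q zs] by auto
      with c show ?thesis unfolding lobe_rel_def by (metis insertE subsetD)
    qed
  qed
qed

lemma connected_avoiding:
  assumes "connected_in (V - {v}) E" "u \<in> V - {v}" "w \<in> V - {v}"
  shows "(avoiding E v)\<^sup>*\<^sup>* u w"
proof -
  have "(\<lambda>a b. E a b \<and> a \<in> V - {v} \<and> b \<in> V - {v})\<^sup>*\<^sup>* u w"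
    using assms unfolding connected_in_def by blast
  then show ?thesis by (rule rtranclp_mono[THEN predicate2D, rotated]) auto
qed

lemma connected_in_closed:
  assumes "connected_in V E" "a \<in> V" "a \<in> T" "\<And>x y. x \<in> T \<Longrightarrow> E x y \<Longrightarrow> y \<in> T"
  shows "V \<subseteq> T"
proof
  fix y assume "y \<in> V"
  with assms(1,2) have "(\<lambda>u w. E u w \<and> u \<in> V \<and> w \<in> V)\<^sup>*\<^sup>* a y" unfolding connected_in_def by blast
  then show "y \<in> T" by induction (use assms in auto)
qed

text \<open>Everything is compared with the one edge \<open>{a, b}\<close>, so transitivity of
  \<open>lobe_rel\<close> is avoided: a cycle through \<open>{a, b}\<close> and
  \<open>{v, u}\<close> yields, by an ear, one through any further edge at \<open>u\<close>, because
  \<open>u\<close> is not a cut vertex.\<close>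

lemma biconnected_lobe_rel:
  assumes sg: "simple_graph V E" and bi: "biconnected V E" and ab: "E a b" and cd: "E c d"
  shows "lobe_rel E {a, b} {c, d}"
proof -
  have in_V: "x \<in> V \<and> y \<in> V \<and> E y x \<and> x \<noteq> y" if "E x y" for x y
    using sg[unfolded simple_graph_def, rule_format, OF that] by simp
  have av: "(avoiding E v)\<^sup>*\<^sup>* u w" if "v \<in> V" "u \<in> V - {v}" "w \<in> V - {v}" for u v w
  proof (rule connected_avoiding)
    show "connected_in (V - {v}) E" using bi that(1) by (simp add: biconnected_def)
  qed (use that in auto)
  define T where "T = {v. \<forall>u. E v u \<longrightarrow> lobe_rel E {a, b} {v, u}}"
  have aT: "a \<in> T"
  proof -
    have "lobe_rel E {a, b} {a, u}" if "E a u" for u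
      using lobe_rel_adjacent[OF sg ab that] av[of a b u] in_V[OF ab] in_V[OF that] by auto
    then show ?thesis by (simp add: T_def)
  qed
  have bT: "b \<in> T"
  proof -
    have "lobe_rel E {b, a} {b, u}" if "E b u" for u
      using lobe_rel_adjacent[OF sg _ that, of a] av[of b a u] in_V[OF ab] in_V[OF that] by auto
    then show ?thesis by (simp add: T_def insert_commute)
  qed
  have "u \<in> T" if v: "v \<in> T" and vu: "E v u" for v u
  proof (cases "{a, b} = {v, u}")
    \<comment> \<open>Equal edges are related without a cycle, so there is nothing to attach an ear
      to; but then \<open>u\<close> is \<open>a\<close> or \<open>b\<close>.\<close>
    case True
    then show ?thesis using aT bT by (auto simp: doubleton_eq_iff)
  next
    case False
    with v vu obtain cs where cs: "is_cycle E cs" "{a, b} \<in> cycle_edges cs" "{v, u} \<in> cycle_edges cs"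
      unfolding T_def lobe_rel_def by blast
    then have "{v, u} \<subseteq> set cs" using path_edges_subset[of "{v, u}" "cs @ [hd cs]"]
      by (cases cs) (auto simp: cycle_edges_eq is_cycle_def)
    then have vs: "v \<in> set cs" "u \<in> set cs" by auto
    show ?thesis unfolding T_def
    proof safe
      fix w assume uw: "E u w"
      show "lobe_rel E {a, b} {u, w}"
        using lobe_rel_ear[OF sg cs(1,2) vs(2) uw vs(1)] av[of u w v] in_V[OF uw] in_V[OF vu] by auto
    qed
  qed
  moreover have "connected_in V E" using bi unfolding biconnected_def by blast
  ultimately have "V \<subseteq> T" using connected_in_closed[of V E a T] aT in_V[OF ab] by simp
  then show ?thesis using cd in_V[OF cd] by (auto simp: T_def)
qed

text \<open>A cycle cannot leave \<open>D\<close> and come back, because it would pass through \<open>p\<close> twice.\<close>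

lemma cycle_through_cut_vertex:
  assumes sg: "simple_graph V E" and cs: "is_cycle E cs"
    and cut: "\<And>u w. E u w \<Longrightarrow> u \<in> D \<Longrightarrow> w \<in> insert p D"
    and e: "{a, b} \<in> cycle_edges cs" "a \<noteq> b" "{a, b} \<subseteq> insert p D"
    and f: "{c, d} \<in> cycle_edges cs" "c \<noteq> d" "{c, d} \<inter> D = {}"
  shows False
proof -
  have one_side: "set xs \<subseteq> D \<or> set xs \<inter> D = {}" if "successively E xs" "p \<notin> set xs" for xs
    using that
  proof (induction xs rule: path_edges.induct)
    case (1 x y zs)
    \<comment> \<open>\<open>cut\<close> controls only edges that leave \<open>D\<close>; an edge
      that enters \<open>D\<close> is treated through its reverse.\<close>
    have "E x y" "E y x" using 1 sg unfolding simple_graph_def by auto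
    with 1 cut[of x y] cut[of y x] show ?case by auto
  qed auto
  have sub: "{a, b} \<subseteq> set cs" "{c, d} \<subseteq> set cs"
    using path_edges_subset[of _ "cs @ [hd cs]"] e f cs
    by (cases cs; fastforce simp: cycle_edges_eq is_cycle_def)+
  \<comment> \<open>Deleting \<open>p\<close> from the cycle, if it lies there, leaves a single path
    through all other vertices.\<close>
  obtain xs where xs: "set cs \<subseteq> insert p (set xs)" "p \<notin> set xs" "successively E xs"
  proof (cases "p \<in> set cs")
    case True
    obtain ys where "is_cycle E (p # ys)" "set (p # ys) = set cs"
      using cycle_rotate_to[OF cs True] by metis
    then show thesis using that[of ys]
      by (cases ys) (auto simp: is_cycle_iff successively_append_iff successively_Cons hd_append
        split: if_splits)
  next
    case False
    with cs show thesis using that[of cs]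
      by (auto simp: is_cycle_iff successively_append_iff split: if_splits)
  qed
  \<comment> \<open>Each of the two edges has an end other than \<open>p\<close>; both ends lie on
    \<open>xs\<close>, one in \<open>D\<close> and one outside.\<close>
  from one_side[OF xs(3,2)] show False using xs sub e f by auto
qed

lemma lobe_rel_image:
  assumes rel: "lobe_rel E e e'" and e: "e \<subseteq> V" and f: "inj_on f V"
    and hom: "\<And>x y. E x y \<Longrightarrow> x \<in> V \<and> y \<in> V \<and> E' (f x) (f y)"
  shows "lobe_rel E' (f ` e) (f ` e')"
proof (cases "e = e'")
  case False
  with rel obtain cs where cs: "is_cycle E cs" "e \<in> cycle_edges cs" "e' \<in> cycle_edges cs"
    unfolding lobe_rel_def by blast
  then have V: "set cs \<subseteq> V" using hom unfolding is_cycle_def by (metis in_set_conv_nth subsetI)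
  have nth: "map f cs ! ((i + 1) mod length cs) = f (cs ! ((i + 1) mod length cs))"
    if "i < length cs" for i
  proof -
    have "(i + 1) mod length cs < length cs" using that by (intro mod_less_divisor) linarith
    then show ?thesis by (rule nth_map)
  qed
  have img: "f ` g \<in> cycle_edges (map f cs)" if g: "g \<in> cycle_edges cs" for g
  proof -
    obtain i where "i < length cs" "g = {cs ! i, cs ! ((i + 1) mod length cs)}"
      using g by (auto simp: cycle_edges_def)
    then have "f ` g = {map f cs ! i, map f cs ! ((i + 1) mod length (map f cs))}" "i < length (map f cs)"
      using nth[of i] by simp_all
    then show ?thesis unfolding cycle_edges_def mem_Collect_eq by (intro exI conjI)
  qed
  have "is_cycle E' (map f cs)"
    unfolding is_cycle_def
  proof (intro conjI allI impI)
    show "3 \<le> length (map f cs)" "distinct (map f cs)"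
      using cs(1) V f by (auto simp: is_cycle_def distinct_map inj_on_subset)
    fix i assume "i < length (map f cs)"
    then show "E' (map f cs ! i) (map f cs ! ((i + 1) mod length (map f cs)))"
      using cs(1) hom nth[of i] by (simp add: is_cycle_def)
  qed
  with img cs show ?thesis unfolding lobe_rel_def by blast
qed (simp add: lobe_rel_def)

lemma avoiding_step:
  assumes "(avoiding E v)\<^sup>*\<^sup>* u w" "E w z" "w \<noteq> v" "z \<noteq> v"
  shows "(avoiding E v)\<^sup>*\<^sup>* u z"
  using assms(1) by (rule rtranclp.rtrancl_into_rtrancl) (simp add: assms)

lemma avoiding_reverse:
  assumes "simple_graph V E" "(avoiding E v)\<^sup>*\<^sup>* u w"
  shows "(avoiding E v)\<^sup>*\<^sup>* w u"
  using assms(2)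
proof (induction rule: rtranclp_induct)
  case (step y z)
  from step(2) have "avoiding E v z y" using assms(1) by (simp add: simple_graph_def)
  then show ?case using step.IH by (rule converse_rtranclp_into_rtranclp)
qed simp

lemma lobe_verts_subset:
  assumes "simple_graph V E" "C \<in> lobes E"
  shows "lobe_verts C \<subseteq> V"
proof
  fix v assume "v \<in> lobe_verts C"
  then obtain e where "e \<in> edges E" "v \<in> e"
    using assms(2) unfolding lobe_verts_def lobes_def by auto
  then obtain u w where "E u w" "v = u \<or> v = w" unfolding edges_def by blast
  then show "v \<in> V" using assms(1) by (auto simp: simple_graph_def)
qed

section \<open>Graphs with prescribed lobes\<close>

locale biconnected_action =
  fixes V0 :: "'a set" and E0 :: "'a \<Rightarrow> 'a \<Rightarrow> bool" and H :: "('a \<Rightarrow> 'a) set"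
  assumes simple: "simple_graph V0 E0"
    and countable_V0: "countable V0"
    and biconnected: "biconnected V0 E0"
    and subgroup: "aut_subgroup H V0 E0"
begin

definition orb :: "'a \<Rightarrow> 'a set" where
  "orb a = (\<lambda>h. h a) ` H"

lemma E0D: "E0 x y \<Longrightarrow> x \<in> V0 \<and> y \<in> V0 \<and> E0 y x \<and> x \<noteq> y"
  using simple by (simp add: simple_graph_def)

lemma H_Aut: "h \<in> H \<Longrightarrow> h \<in> Aut V0 E0"
  using subgroup unfolding aut_subgroup_def by blast

lemma H_bij: "h \<in> H \<Longrightarrow> bij_betw h V0 V0"
  using H_Aut unfolding Aut_def graph_iso_def by blast

lemma H_in: "h \<in> H \<Longrightarrow> x \<in> V0 \<Longrightarrow> h x \<in> V0"
  using H_bij bij_betwE by blast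

lemma H_E0: "h \<in> H \<Longrightarrow> x \<in> V0 \<Longrightarrow> y \<in> V0 \<Longrightarrow> E0 (h x) (h y) \<longleftrightarrow> E0 x y"
  using H_Aut unfolding Aut_def graph_iso_def by blast

lemma id_H: "id \<in> H"
  using subgroup unfolding aut_subgroup_def by blast

lemma orb_self: "x \<in> orb x"
  unfolding orb_def using image_eqI[OF _ id_H, of x "\<lambda>h. h x"] by simp

lemma orb_in: "y \<in> orb x \<Longrightarrow> x \<in> V0 \<Longrightarrow> y \<in> V0"
  unfolding orb_def using H_in by blast

lemma orb_trans: "y \<in> orb x \<Longrightarrow> z \<in> orb y \<Longrightarrow> z \<in> orb x"
proof -
  assume "y \<in> orb x" "z \<in> orb y"
  then obtain g h where gh: "g \<in> H" "h \<in> H" "z = g (h x)" unfolding orb_def by blast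
  then have "g \<circ> h \<in> H" using subgroup unfolding aut_subgroup_def by blast
  with gh show "z \<in> orb x" unfolding orb_def by (intro image_eqI[of _ _ "g \<circ> h"]) auto
qed

lemma orb_sym: "y \<in> orb x \<Longrightarrow> x \<in> orb y"
proof -
  assume "y \<in> orb x"
  then obtain h where h: "h \<in> H" "y = h x" unfolding orb_def by blast
  then obtain h' where h': "h' \<in> H" "h' \<circ> h = id" using subgroup unfolding aut_subgroup_def by blast
  then have "h' y = x" using h by (simp add: fun_eq_iff)
  with h' show "x \<in> orb y" unfolding orb_def by blast
qed

lemma orb_eq: "y \<in> orb x \<Longrightarrow> orb y = orb x"
  using orb_trans orb_sym by blast

lemma connected_V0: "connected_in V0 E0"
  using biconnected unfolding biconnected_def by blast

lemma other_vertex: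
  obtains y where "y \<in> V0" "y \<noteq> x"
  using biconnected unfolding biconnected_def by metis

lemma path_V0: "x \<in> V0 \<Longrightarrow> y \<in> V0 \<Longrightarrow> E0\<^sup>*\<^sup>* x y"
proof -
  assume "x \<in> V0" "y \<in> V0"
  then have "(\<lambda>u w. E0 u w \<and> u \<in> V0 \<and> w \<in> V0)\<^sup>*\<^sup>* x y"
    using connected_V0 unfolding connected_in_def by simp
  then show ?thesis by (rule rtranclp_mono[THEN predicate2D, rotated]) auto
qed

lemma neighbour:
  assumes "x \<in> V0"
  obtains y where "E0 x y"
proof -
  obtain z where "z \<in> V0" "z \<noteq> x" using other_vertex .
  with path_V0[OF assms] have "E0\<^sup>*\<^sup>* x z" "x \<noteq> z" by auto
  then show thesis using that by (metis converse_rtranclpE)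
qed

lemma path_V0_avoiding:
  assumes "x \<in> V0" "y \<in> V0 - {x}" "z \<in> V0 - {x}"
  shows "(avoiding E0 x)\<^sup>*\<^sup>* y z"
  using assms connected_avoiding biconnected unfolding biconnected_def by fastforce

end

text \<open>The number \<open>m x a\<close> stands for \<open>\<mu>\<^sub>k(j)\<close>, where \<open>x \<in> R\<^sub>k\<close> and \<open>a \<in> Q\<^sub>j\<close>.\<close>

locale lobe_pattern = biconnected_action V0 E0 H
  for V0 :: "'a set" and E0 :: "'a \<Rightarrow> 'a \<Rightarrow> bool" and H :: "('a \<Rightarrow> 'a) set" +
  fixes m :: "'a \<Rightarrow> 'a \<Rightarrow> enat"
  assumes m_left: "h \<in> H \<Longrightarrow> x \<in> V0 \<Longrightarrow> m (h x) a = m x a"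
    and m_right: "h \<in> H \<Longrightarrow> a \<in> V0 \<Longrightarrow> m x (h a) = m x a"
    and m_self: "x \<in> V0 \<Longrightarrow> m x x > 0"
    and m_class: "x \<in> V0 \<Longrightarrow> a \<in> V0 \<Longrightarrow> m x a > 0 \<Longrightarrow> m a b = m x b"
begin

lemma m_orb_left: "y \<in> orb x \<Longrightarrow> x \<in> V0 \<Longrightarrow> m y a = m x a"
  unfolding orb_def using m_left by auto

lemma m_orb_right: "b \<in> orb a \<Longrightarrow> a \<in> V0 \<Longrightarrow> m x b = m x a"
  unfolding orb_def using m_right by auto

end

text \<open>Vertices are addressed by a position \<open>x\<close> in a lobe \<open>C\<close>. As
  \<open>C\<close> itself is counted for the orbit of \<open>x\<close>, the index \<open>k\<close>
  of the vertex must be the class of \<open>x\<close>; so the quantifier over \<open>k\<close> in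
  \<open>realizes\<close> disappears.\<close>

locale lobe_graph = lobe_pattern V0 E0 H m
  for V0 :: "'a set" and E0 :: "'a \<Rightarrow> 'a \<Rightarrow> bool" and H :: "('a \<Rightarrow> 'a) set"
    and m :: "'a \<Rightarrow> 'a \<Rightarrow> enat" +
  fixes V :: "'v set" and E :: "'v \<Rightarrow> 'v \<Rightarrow> bool" and \<sigma> :: "'v set set \<Rightarrow> 'a \<Rightarrow> 'v"
  assumes simple_G: "simple_graph V E"
    and countable_V: "countable V"
    and connected_G: "connected_in V E"
    and sigma_iso: "C \<in> lobes E \<Longrightarrow> graph_iso V0 E0 (lobe_verts C) (lobe_adj C) (\<sigma> C)"
    and lobe_count: "C \<in> lobes E \<Longrightarrow> x \<in> V0 \<Longrightarrow> a \<in> V0 \<Longrightarrow>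
      ecard {C' \<in> lobes E. \<sigma> C x \<in> \<sigma> C' ` orb a} = m x a"
begin

lemma ED: "E x y \<Longrightarrow> x \<in> V \<and> y \<in> V \<and> E y x \<and> x \<noteq> y"
  using simple_G by (simp add: simple_graph_def)

lemma edges_iff: "{u, w} \<in> edges E \<longleftrightarrow> E u w"
  unfolding edges_def using ED by (auto simp: doubleton_eq_iff)

lemma lobe_edges: "C \<in> lobes E \<Longrightarrow> C \<subseteq> edges E"
  unfolding lobes_def by auto

lemma lobe_E: "C \<in> lobes E \<Longrightarrow> {u, w} \<in> C \<Longrightarrow> E u w"
  using lobe_edges edges_iff by blast

lemma sigma_bij: "C \<in> lobes E \<Longrightarrow> bij_betw (\<sigma> C) V0 (lobe_verts C)"
  using sigma_iso unfolding graph_iso_def by blast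

lemma sigma_inj: "C \<in> lobes E \<Longrightarrow> inj_on (\<sigma> C) V0"
  by (rule bij_betw_imp_inj_on[OF sigma_bij])

lemma sigma_verts: "C \<in> lobes E \<Longrightarrow> \<sigma> C ` V0 = lobe_verts C"
  by (rule bij_betw_imp_surj_on[OF sigma_bij])

lemma sigma_adj: "C \<in> lobes E \<Longrightarrow> x \<in> V0 \<Longrightarrow> y \<in> V0 \<Longrightarrow> {\<sigma> C x, \<sigma> C y} \<in> C \<longleftrightarrow> E0 x y"
  using sigma_iso unfolding graph_iso_def lobe_adj_def by blast

lemma sigma_edge: "C \<in> lobes E \<Longrightarrow> E0 x y \<Longrightarrow> {\<sigma> C x, \<sigma> C y} \<in> C"
  using sigma_adj E0D by blast

lemma sigma_E: "C \<in> lobes E \<Longrightarrow> E0 x y \<Longrightarrow> E (\<sigma> C x) (\<sigma> C y)"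
  using sigma_edge lobe_E by blast

lemma lobe_edge_cases:
  assumes "C \<in> lobes E" "{u, w} \<in> C"
  obtains x y where "E0 x y" "u = \<sigma> C x" "w = \<sigma> C y"
proof -
  have "u \<in> lobe_verts C" "w \<in> lobe_verts C" using assms(2) unfolding lobe_verts_def by auto
  then obtain x y where xy: "x \<in> V0" "y \<in> V0" "u = \<sigma> C x" "w = \<sigma> C y"
    using sigma_verts[OF assms(1)] by blast
  with assms sigma_adj have "E0 x y" by blast
  with xy that show thesis by blast
qed

lemma lobe_edge_doubleton:
  assumes "C \<in> lobes E" "e \<in> C"
  obtains u w where "e = {u, w}" "E u w"
  using lobe_edges[OF assms(1)] assms(2) unfolding edges_def by blast

text \<open>\<open>\<sigma> C\<close> carries a common cycle of two edges of the biconnected model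
  into the graph.\<close>

lemma lobe_rel_lobe:
  assumes C: "C \<in> lobes E" and e: "e \<in> C" "e' \<in> C"
  shows "lobe_rel E e e'"
proof -
  obtain u w where u: "e = {u, w}" using lobe_edge_doubleton C e by metis
  obtain u' w' where u': "e' = {u', w'}" using lobe_edge_doubleton C e by metis
  obtain x y where x: "E0 x y" "u = \<sigma> C x" "w = \<sigma> C y" using lobe_edge_cases[OF C] e(1) u by metis
  obtain x' y' where x': "E0 x' y'" "u' = \<sigma> C x'" "w' = \<sigma> C y'"
    using lobe_edge_cases[OF C] e(2) u' by metis
  have "lobe_rel E (\<sigma> C ` {x, y}) (\<sigma> C ` {x', y'})"
  proof (rule lobe_rel_image)
    show "lobe_rel E0 {x, y} {x', y'}" using biconnected_lobe_rel simple biconnected x(1) x'(1) .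
    show "inj_on (\<sigma> C) V0" using sigma_inj C .
  qed (use E0D x(1) sigma_E[OF C] in auto)
  with x x' u u' show ?thesis by simp
qed

text \<open>Hence the classes \<^prop>\<open>C \<in> lobes E\<close> really are equivalence classes, although
  transitivity of \<^const>\<open>lobe_rel\<close> is not available a priori.\<close>

lemma lobe_closed:
  assumes C: "C \<in> lobes E" and e: "e \<in> C" "e' \<in> edges E" "lobe_rel E e e'"
  shows "e' \<in> C"
proof -
  obtain e0 where e0: "e0 \<in> edges E" "C = {e' \<in> edges E. lobe_rel E e0 e'}"
    using C unfolding lobes_def by blast
  define C' where "C' = {e' \<in> edges E. lobe_rel E e e'}"
  have eE: "e \<in> edges E" "lobe_rel E e0 e" using e(1) e0(2) by auto
  then have C': "C' \<in> lobes E" unfolding lobes_def C'_def by blast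
  have "e0 \<in> C'" "e' \<in> C'" using e eE e0 lobe_rel_sym unfolding C'_def by blast+
  then have "lobe_rel E e0 e'" using lobe_rel_lobe C' by blast
  with e(2) e0(2) show ?thesis by blast
qed

lemma lobe_eqI:
  assumes "C \<in> lobes E" "C' \<in> lobes E" "e \<in> C" "e' \<in> C'" "lobe_rel E e e'"
  shows "C = C'"
proof
  have "e' \<in> C" using lobe_closed[OF assms(1,3) _ assms(5)] lobe_edges[OF assms(2)] assms(4) by blast
  then show "C \<subseteq> C'" "C' \<subseteq> C"
    using lobe_closed lobe_rel_lobe lobe_edges assms(1,2,4) by (meson subsetD subsetI)+
qed

lemma ex_lobe:
  assumes "E u w"
  obtains C where "C \<in> lobes E" "{u, w} \<in> C"
proof -
  have "{u, w} \<in> edges E" using assms edges_iff by blast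
  then show thesis using that[of "{e' \<in> edges E. lobe_rel E {u, w} e'}"]
    unfolding lobes_def lobe_rel_def by blast
qed

lemma lobe_verts_V: "C \<in> lobes E \<Longrightarrow> lobe_verts C \<subseteq> V"
  using lobe_verts_subset simple_G .

section \<open>Branches at a vertex\<close>

definition branch :: "'v set set \<Rightarrow> 'v \<Rightarrow> 'v set" where
  "branch C v = {w. \<exists>u. {v, u} \<in> C \<and> (avoiding E v)\<^sup>*\<^sup>* u w}"

text \<open>\<open>branch C v\<close> collects what can be reached after entering \<open>C\<close>
  from \<open>v\<close> without returning to \<open>v\<close>. If two lobes entered the same
  component, a path between the neighbours of \<open>v\<close> would close through \<open>v\<close>
  to a cycle that joins them.\<close>

lemma branch_disjoint:
  assumes "C \<in> lobes E" "C' \<in> lobes E" "w \<in> branch C v" "w \<in> branch C' v"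
  shows "C = C'"
proof -
  from assms obtain u u' where u: "{v, u} \<in> C" "(avoiding E v)\<^sup>*\<^sup>* u w" "{v, u'} \<in> C'"
    "(avoiding E v)\<^sup>*\<^sup>* u' w" unfolding branch_def by blast
  have "(avoiding E v)\<^sup>*\<^sup>* u u'" using u(2) avoiding_reverse[OF simple_G u(4)] by (rule rtranclp_trans)
  then have "lobe_rel E {v, u} {v, u'}"
    using lobe_rel_adjacent[OF simple_G] lobe_E assms u by blast
  then show ?thesis using lobe_eqI assms u by blast
qed

lemma branch_neq:
  assumes "C \<in> lobes E" "w \<in> branch C v"
  shows "w \<noteq> v"
proof -
  from assms obtain u where u: "{v, u} \<in> C" "(avoiding E v)\<^sup>*\<^sup>* u w" unfolding branch_def by blast
  have "u \<noteq> v" using lobe_E[OF assms(1) u(1)] ED by blast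
  with u(2) show ?thesis by (induction rule: rtranclp_induct) auto
qed

lemma branch_step:
  assumes "w \<in> branch C v" "w \<noteq> v" "E w z" "z \<noteq> v"
  shows "z \<in> branch C v"
proof -
  from assms(1) obtain u where u: "{v, u} \<in> C" "(avoiding E v)\<^sup>*\<^sup>* u w"
    unfolding branch_def by blast
  from avoiding_step[OF u(2) assms(3,2,4)] u(1) show ?thesis unfolding branch_def by blast
qed

text \<open>The position of \<open>v\<close> is no cut vertex of the model, so the rest of the lobe
  stays connected without it; injectivity of \<open>\<sigma> C\<close> keeps the image of the path
  away from \<open>v\<close>.\<close>

lemma lobe_branch:
  assumes C: "C \<in> lobes E" and vu: "v \<in> lobe_verts C" "u \<in> lobe_verts C" "u \<noteq> v"
  shows "u \<in> branch C v"
proof -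
  obtain x y where x: "x \<in> V0" "v = \<sigma> C x" and y: "y \<in> V0" "u = \<sigma> C y"
    using vu sigma_verts[OF C] by blast
  obtain z where z: "E0 x z" using neighbour x(1) by blast
  have "(avoiding E0 x)\<^sup>*\<^sup>* z y" using path_V0_avoiding x y vu(3) E0D[OF z] by auto
  then have "(avoiding E v)\<^sup>*\<^sup>* (\<sigma> C z) (\<sigma> C y)"
  proof (induction rule: rtranclp_induct)
    case (step y y')
    have E: "E (\<sigma> C y) (\<sigma> C y')" using sigma_E[OF C] step(2) by simp
    have "y \<in> V0" "y' \<in> V0" "y \<noteq> x" "y' \<noteq> x" using step(2) E0D by auto
    then have "\<sigma> C y \<noteq> v" "\<sigma> C y' \<noteq> v"
      unfolding x(2) using x(1) inj_on_eq_iff[OF sigma_inj[OF C]] by simp_all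
    with step.IH E show ?case by (rule avoiding_step)
  qed simp
  moreover have "{v, \<sigma> C z} \<in> C" using sigma_edge[OF C z] x by simp
  ultimately show ?thesis unfolding branch_def y(2) by blast
qed

text \<open>\<open>v\<close> lies in the branch of \<open>C\<close> at \<open>u\<close>, hence not
  in that of \<open>C'\<close>. A walk that enters \<open>C'\<close> from \<open>u\<close> and does
  not return to \<open>u\<close> therefore never reaches \<open>v\<close>.\<close>

lemma branch_chain:
  assumes C: "C \<in> lobes E" and C': "C' \<in> lobes E" and "C \<noteq> C'"
    and vu: "v \<in> lobe_verts C" "u \<in> lobe_verts C" "u \<noteq> v" and w: "w \<in> branch C' u"
  shows "w \<in> branch C v"
proof -
  have v: "v \<notin> branch C' u"
    using lobe_branch[OF C vu(2,1)] vu(3) branch_disjoint[OF C C'] \<open>C \<noteq> C'\<close> by blast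
  obtain u1 where u1: "{u, u1} \<in> C'" "(avoiding E u)\<^sup>*\<^sup>* u1 w" using w unfolding branch_def by blast
  \<comment> \<open>Membership in the second branch is carried along, because it keeps the next
    vertex different from \<open>v\<close>.\<close>
  have "w \<in> branch C v \<and> w \<in> branch C' u" using u1(2)
  proof (induction rule: rtranclp_induct)
    case base
    have "u1 \<in> branch C' u" using u1(1) unfolding branch_def by blast
    moreover from this v have "u1 \<noteq> v" by blast
    ultimately show ?case
      using branch_step[OF lobe_branch[OF C vu]] vu(3) lobe_E[OF C' u1(1)] by blast
  next
    case (step y z)
    then have "z \<in> branch C' u" using branch_step by blast
    moreover from this v have "z \<noteq> v" by blast
    ultimately show ?case using step branch_step branch_neq[OF C] by blast
  qed
  then show ?thesis ..
qed

end

section \<open>The tree of lobes\<close>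

text \<open>An index set of prescribed size that serves finite and infinite multiplicities
  alike.\<close>

lemma ecard_enat_less: "ecard {n. enat n < k} = k"
proof (cases k)
  case (enat i)
  then have "{n. enat n < k} = {..<i}" by auto
  with enat show ?thesis by (simp add: ecard_def)
qed (simp add: ecard_def)

lemma ecard_image: "inj_on f S \<Longrightarrow> ecard (f ` S) = ecard S"
  by (simp add: ecard_def card_image finite_image_iff)

lemma connected_inI:
  assumes sg: "simple_graph V E" and r: "r \<in> V" and reach: "\<And>x. x \<in> V \<Longrightarrow> E\<^sup>*\<^sup>* r x"
  shows "connected_in V E"
proof -
  let ?R = "\<lambda>u w. E u w \<and> u \<in> V \<and> w \<in> V"
  have R: "?R = E" using sg by (auto simp: simple_graph_def fun_eq_iff)
  have "E\<^sup>*\<^sup>* x r" if "x \<in> V" for x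
    using reach[OF that]
  proof (induction rule: rtranclp_induct)
    case (step y z)
    have "E z y" using step(2) sg by (simp add: simple_graph_def)
    then show ?case using step.IH by (rule converse_rtranclp_into_rtranclp)
  qed simp
  then have "E\<^sup>*\<^sup>* x y" if "x \<in> V" "y \<in> V" for x y
    using that reach by (meson rtranclp_trans)
  then show ?thesis using r unfolding connected_in_def R by blast
qed

section \<open>Slots, lists of steps and normal forms of vertices\<close>

context lobe_pattern
begin

text \<open>The choice refers to \<open>x\<close> only through \<open>orb x\<close>, so it is
  constant on orbits.\<close>

definition rep :: "'a \<Rightarrow> 'a" where
  "rep x = (SOME y. y \<in> orb x)"

lemma rep_orb: "rep x \<in> orb x"
  unfolding rep_def using orb_self by (rule someI)

lemma rep_eq: "y \<in> orb x \<Longrightarrow> rep y = rep x"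
  unfolding rep_def using orb_eq by simp

lemma rep_rep [simp]: "rep (rep x) = rep x"
  using rep_eq rep_orb .

lemma rep_V0: "x \<in> V0 \<Longrightarrow> rep x \<in> V0"
  using orb_in rep_orb .

lemma orb_rep: "orb (rep x) = orb x"
  using orb_eq rep_orb .

lemma rep_eq_iff: "rep x = rep y \<longleftrightarrow> x \<in> orb y"
  using rep_eq rep_orb orb_rep orb_self by metis

text \<open>One entry for each lobe that a vertex at position \<open>x\<close> must lie in. Only
  representatives occur as \<open>a\<close>, since \<open>H\<close> can turn a lobe until its
  position of attachment is one.\<close>

definition slots :: "'a \<Rightarrow> ('a \<times> nat) set" where
  "slots x = {(a, n). a \<in> rep ` V0 \<and> enat n < m x a}"

lemma slotsD: "(a, n) \<in> slots x \<Longrightarrow> a \<in> V0 \<and> rep a = a \<and> enat n < m x a"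
  unfolding slots_def using rep_V0 by auto

lemma slots_self: "x \<in> V0 \<Longrightarrow> (rep x, 0) \<in> slots x"
  using m_self[of x] m_orb_right[OF rep_orb, of x x] by (simp add: slots_def zero_enat_def)

lemma slots_orb: "y \<in> orb x \<Longrightarrow> x \<in> V0 \<Longrightarrow> slots y = slots x"
  unfolding slots_def using m_orb_left by simp

text \<open>A lobe attached at \<open>x\<close> meets the vertex in a position of the same class, so
  both lobes prescribe the same numbers for the vertex that they share.\<close>

lemma slots_m:
  assumes "x \<in> V0" "(a, n) \<in> slots x"
  shows "m a b = m x b"
proof -
  have "m x a > 0" using slotsD[OF assms(2)] by (metis gr_implies_not_zero zero_less_iff_neq_zero)
  then show ?thesis using m_class assms slotsD by blast
qed

text \<open>A lobe of the tree is a list of steps, the last one first. The step \<open>(x, a, n)\<close> leads from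
  the position \<open>x\<close> of the parent lobe to the \<open>n\<close>-th lobe that is attached there at its position
  \<open>a\<close>; the slot \<open>(rep x, 0)\<close> belongs to the parent lobe itself. The position of attachment is
  identified with a position of the parent, and \<open>place\<close> resolves this identification.\<close>

fun attach :: "('a \<times> 'a \<times> nat) list \<Rightarrow> 'a set" where
  "attach [] = {}"
| "attach ((x, a, n) # L) = {a}"

text \<open>\<open>x \<notin> attach L\<close> lets lobes at the attachment vertex of
  \<open>L\<close> be listed from the parent only; otherwise this vertex would receive its lobes
  twice.\<close>

fun valid :: "('a \<times> 'a \<times> nat) list \<Rightarrow> bool" where
  "valid [] = True"
| "valid ((x, a, n) # L) \<longleftrightarrow>
     valid L \<and> x \<in> V0 \<and> x \<notin> attach L \<and> (a, n) \<in> slots x \<and> (a, n) \<noteq> (rep x, 0)"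

fun place :: "('a \<times> 'a \<times> nat) list \<Rightarrow> 'a \<Rightarrow> ('a \<times> 'a \<times> nat) list \<times> 'a" where
  "place [] y = ([], y)"
| "place ((x, a, n) # L) y = (if y = a then (L, x) else ((x, a, n) # L, y))"

definition nodes :: "(('a \<times> 'a \<times> nat) list \<times> 'a) set" where
  "nodes = {(L, x). valid L \<and> x \<in> V0 \<and> x \<notin> attach L}"

text \<open>\<open>nodes\<close> names each vertex in its lobe nearest to the root. Numbering these
  normal forms turns gluing into equality of natural numbers.\<close>

definition pos :: "('a \<times> 'a \<times> nat) list \<Rightarrow> 'a \<Rightarrow> nat" where
  "pos L x = to_nat_on nodes (place L x)"

lemma place_node: "x \<notin> attach L \<Longrightarrow> place L x = (L, x)"
  by (cases L rule: attach.cases) auto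

lemma place_cases:
  assumes "valid L"
  obtains "x \<notin> attach L" "place L x = (L, x)"
  | y n M where "L = (y, x, n) # M" "place L x = (M, y)"
  using assms by (cases L rule: attach.cases) (auto split: if_splits)

lemma place_nodes:
  assumes "valid L" "x \<in> V0"
  shows "place L x \<in> nodes"
  using assms by (cases L rule: attach.cases) (auto simp: nodes_def)

lemma countable_nodes: "countable nodes"
proof -
  have "set L \<subseteq> V0 \<times> V0 \<times> UNIV" if "valid L" for L
    using that by (induction L rule: valid.induct) (auto dest: slotsD)
  then have "nodes \<subseteq> lists (V0 \<times> V0 \<times> UNIV) \<times> V0" unfolding nodes_def by auto
  moreover have "countable \<dots>" using countable_V0 by (intro countable_SIGMA countable_lists) auto
  ultimately show ?thesis by (rule countable_subset)
qed

lemma pos_eq_iff: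
  assumes "valid L" "x \<in> V0" "valid M" "y \<in> V0"
  shows "pos L x = pos M y \<longleftrightarrow> place L x = place M y"
  unfolding pos_def using assms place_nodes countable_nodes by simp

lemma pos_inj: "valid L \<Longrightarrow> inj_on (pos L) V0"
  by (rule inj_onI) (cases L rule: attach.cases; auto simp: pos_eq_iff split: if_splits)

lemma nodesD: "(L, x) \<in> nodes \<Longrightarrow> valid L \<and> x \<in> V0 \<and> x \<notin> attach L"
  by (simp add: nodes_def)

lemma pos_parent: "valid ((x, a, n) # L) \<Longrightarrow> pos ((x, a, n) # L) a = pos L x"
  by (simp add: pos_def place_node)

text \<open>\<open>place\<close> goes up at most one step, so the lobes through the vertex
  \<open>(M, y)\<close> are \<open>M\<close> and its children at \<open>y\<close>.\<close>

lemma pos_eq_node: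
  assumes "valid L" "x \<in> V0" "(M, y) \<in> nodes" "pos L x = pos M y"
  shows "L = M \<and> x = y \<or> (\<exists>n. L = (y, x, n) # M)"
proof -
  have "place L x = (M, y)" using assms pos_eq_iff[of L x M y] nodesD[OF assms(3)] place_node by simp
  with place_cases[OF assms(1), of x] show ?thesis by fastforce
qed

lemma pos_node:
  assumes "valid L" "x \<in> V0"
  obtains M y where "(M, y) \<in> nodes" "pos L x = pos M y"
proof -
  obtain M y where My: "place L x = (M, y)" by fastforce
  with place_nodes assms have "(M, y) \<in> nodes" by metis
  moreover from this have "pos L x = pos M y"
    using My nodesD place_node by (simp add: pos_def)
  ultimately show thesis by (rule that)
qed

section \<open>The tree as a graph and its separation at attachment vertices\<close>

definition tree_verts :: "nat set" where
  "tree_verts = {pos L x | L x. valid L \<and> x \<in> V0}"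

definition tree_adj :: "nat \<Rightarrow> nat \<Rightarrow> bool" where
  "tree_adj u w \<longleftrightarrow> (\<exists>L x y. valid L \<and> E0 x y \<and> u = pos L x \<and> w = pos L y)"

definition copy :: "('a \<times> 'a \<times> nat) list \<Rightarrow> nat set set" where
  "copy L = {{pos L x, pos L y} | x y. E0 x y}"

text \<open>Steps are added in front, so the descendants of \<open>L\<close> are the lists
  \<open>N @ L\<close>. The attachment vertex of \<open>L\<close> is left out, since its normal form
  belongs to the parent.\<close>

definition below :: "('a \<times> 'a \<times> nat) list \<Rightarrow> nat set" where
  "below L = {pos M x | M x. (M, x) \<in> nodes \<and> (\<exists>N. M = N @ L)}"

lemma tree_adjI: "valid L \<Longrightarrow> E0 x y \<Longrightarrow> tree_adj (pos L x) (pos L y)"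
  unfolding tree_adj_def by blast

lemma simple_tree: "simple_graph tree_verts tree_adj"
  unfolding simple_graph_def
proof (intro allI impI)
  fix u w assume "tree_adj u w"
  then obtain L x y where L: "valid L" "E0 x y" "u = pos L x" "w = pos L y"
    unfolding tree_adj_def by blast
  with E0D[OF L(2)] have "tree_adj w u" using tree_adjI by blast
  moreover have "u \<noteq> w" using L E0D[OF L(2)] inj_on_eq_iff[OF pos_inj] by simp
  ultimately show "u \<in> tree_verts \<and> w \<in> tree_verts \<and> tree_adj w u \<and> u \<noteq> w"
    using L E0D[OF L(2)] unfolding tree_verts_def by blast
qed

lemma connected_tree: "connected_in tree_verts tree_adj"
proof -
  obtain r where r: "r \<in> V0" using other_vertex .
  have in_copy: "tree_adj\<^sup>*\<^sup>* (pos L x) (pos L y)" if "valid L" "x \<in> V0" "y \<in> V0" for L x y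
    using path_V0[OF that(2,3)]
  proof (induction rule: rtranclp_induct)
    case (step y z)
    then show ?case using tree_adjI[OF that(1)] by (meson rtranclp.rtrancl_into_rtrancl)
  qed simp
  have "tree_adj\<^sup>*\<^sup>* (pos [] r) (pos L x)" if "valid L" "x \<in> V0" for L x
    using that
  proof (induction L arbitrary: x rule: valid.induct)
    case 1
    then show ?case using in_copy[of "[]"] r by simp
  next
    case (2 y a n L)
    have "a \<in> V0" using 2(2) slotsD by auto
    then have "tree_adj\<^sup>*\<^sup>* (pos ((y, a, n) # L) a) (pos ((y, a, n) # L) x)"
      using in_copy 2 by blast
    moreover have "tree_adj\<^sup>*\<^sup>* (pos [] r) (pos L y)" using 2 by simp
    ultimately show ?case using pos_parent[OF 2(2)] by simp
  qed
  then show ?thesis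
    using connected_inI[OF simple_tree, of "pos [] r"] r valid.simps(1)
    unfolding tree_verts_def by blast
qed

lemma pos_below:
  assumes "valid M" "x \<in> V0"
  shows "pos M x \<in> below L \<longleftrightarrow> (\<exists>N. fst (place M x) = N @ L)"
proof -
  have *: "pos M' x' = pos M x \<longleftrightarrow> (M', x') = place M x" if "(M', x') \<in> nodes" for M' x'
    using that pos_eq_iff[OF _ _ assms, of M' x'] nodesD[OF that] place_node by simp
  obtain M' x' where M': "place M x = (M', x')" by fastforce
  with place_nodes[OF assms] have n: "(M', x') \<in> nodes" by simp
  with *[OF n] M' have p: "pos M x = pos M' x'" by simp
  show ?thesis
  proof
    assume "pos M x \<in> below L"
    then obtain M'' x'' where "(M'', x'') \<in> nodes" "\<exists>N. M'' = N @ L" "pos M x = pos M'' x''"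
      unfolding below_def by blast
    with * show "\<exists>N. fst (place M x) = N @ L" by (metis fst_conv)
  next
    assume "\<exists>N. fst (place M x) = N @ L"
    with M' n p show "pos M x \<in> below L" unfolding below_def by auto
  qed
qed

lemma below_copy: "valid M \<Longrightarrow> y \<in> V0 \<Longrightarrow> pos M y \<in> below L \<Longrightarrow> \<exists>N. M = N @ L"
  using place_cases[of M y] by (cases M rule: attach.cases) (auto simp: pos_below split: if_splits)

lemma copy_below:
  assumes "valid (N @ (x, a, n) # L)" "y \<in> V0"
  shows "pos (N @ (x, a, n) # L) y \<in> insert (pos L x) (below ((x, a, n) # L))"
proof -
  note b = pos_below[OF assms, of "(x, a, n) # L"]
  show ?thesis
  proof (cases N)
    case Nil
    with b assms pos_parent[of x a n L] show ?thesis by auto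
  next
    case (Cons s N')
    then show ?thesis using b by (cases s) (auto split: if_splits)
  qed
qed

lemma parent_not_below:
  assumes "valid ((x, a, n) # L)"
  shows "pos L x \<notin> below ((x, a, n) # L)"
proof
  assume "pos L x \<in> below ((x, a, n) # L)"
  then obtain N where "L = N @ (x, a, n) # L" using below_copy assms by fastforce
  then have "length L = length (N @ (x, a, n) # L)" by simp
  then show False by simp
qed

text \<open>The attachment vertex separates: an edge lies within one copy, and a copy with a vertex
  in \<open>below\<close> belongs to a descendant.\<close>

lemma below_edge:
  assumes uw: "tree_adj u w" and u: "u \<in> below ((x, a, n) # L)"
  shows "w \<in> insert (pos L x) (below ((x, a, n) # L))"
proof -
  obtain M y z where M: "valid M" "E0 y z" "u = pos M y" "w = pos M z"
    using uw unfolding tree_adj_def by blast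
  then obtain N where "M = N @ (x, a, n) # L" using below_copy[of M y] u E0D[OF M(2)] by blast
  with M copy_below[of N x a n L z] E0D[OF M(2)] show ?thesis by simp
qed

text \<open>\<open>copy L\<close> lies in \<open>below L\<close> and the attachment vertex, while
  \<open>copy M\<close> has no vertex in \<open>below L\<close>; a common cycle would cross the
  attachment vertex twice.\<close>

lemma copies_unrelated:
  assumes v: "valid L" "valid M" and not_below: "\<nexists>N. M = N @ L"
    and e: "e \<in> copy L" "f \<in> copy M"
  shows "\<not> lobe_rel tree_adj e f"
proof
  assume rel: "lobe_rel tree_adj e f"
  \<comment> \<open>Every list is a descendant of the root, so \<open>L\<close> is not the root and
    has an attachment vertex.\<close>
  obtain x a n L' where L: "L = (x, a, n) # L'" using not_below by (cases L rule: attach.cases) auto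
  obtain y z where yz: "E0 y z" "e = {pos L y, pos L z}" using e(1) unfolding copy_def by blast
  obtain y' z' where yz': "E0 y' z'" "f = {pos M y', pos M z'}" using e(2) unfolding copy_def by blast
  have ne: "pos L y \<noteq> pos L z" "pos M y' \<noteq> pos M z'"
    using E0D[OF yz(1)] E0D[OF yz'(1)] inj_on_eq_iff[OF pos_inj] v by simp_all
  have e1: "e \<subseteq> insert (pos L' x) (below L)"
    using copy_below[of "[]" x a n L'] v E0D[OF yz(1)] yz(2) L by simp
  have f1: "f \<inter> below L = {}"
    using below_copy[OF v(2)] not_below E0D[OF yz'(1)] yz'(2) by auto
  show False
  proof (cases "e = f")
    case True
    with e1 f1 have "e \<subseteq> {pos L' x}" by auto
    with yz(2) ne show False by auto
  next
    case False
    with rel obtain cs where cs: "is_cycle tree_adj cs" "e \<in> cycle_edges cs" "f \<in> cycle_edges cs"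
      unfolding lobe_rel_def by blast
    show False
    proof (rule cycle_through_cut_vertex[OF simple_tree cs(1)])
      show "w \<in> insert (pos L' x) (below L)" if "tree_adj u w" "u \<in> below L" for u w
        using below_edge that L by blast
    qed (use cs e1 f1 ne yz yz' in auto)
  qed
qed

text \<open>Each list must be a descendant of the other, and mutual suffixes are equal.\<close>

lemma copy_eqI:
  assumes "valid L" "valid M" "e \<in> copy L" "f \<in> copy M" "lobe_rel tree_adj e f"
  shows "L = M"
proof -
  obtain N where "M = N @ L" using copies_unrelated assms by blast
  moreover obtain N' where "L = N' @ M"
    using copies_unrelated[OF assms(2,1) _ assms(4,3)] lobe_rel_sym[OF assms(5)] by blast
  ultimately show ?thesis by simp
qed

lemma copy_lobe_rel:
  assumes L: "valid L" and e: "e \<in> copy L" "f \<in> copy L"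
  shows "lobe_rel tree_adj e f"
proof -
  obtain y z where yz: "E0 y z" "e = {pos L y, pos L z}" using e(1) unfolding copy_def by blast
  obtain y' z' where yz': "E0 y' z'" "f = {pos L y', pos L z'}" using e(2) unfolding copy_def by blast
  have "lobe_rel tree_adj (pos L ` {y, z}) (pos L ` {y', z'})"
  proof (rule lobe_rel_image)
    show "lobe_rel E0 {y, z} {y', z'}" using biconnected_lobe_rel simple biconnected yz(1) yz'(1) .
    show "inj_on (pos L) V0" using pos_inj L .
  qed (use E0D yz(1) tree_adjI[OF L] in auto)
  with yz yz' show ?thesis by simp
qed

lemma copy_nonempty: "copy L \<noteq> {}"
proof -
  obtain x where x: "x \<in> V0" using other_vertex .
  obtain y where "E0 x y" using neighbour[OF x] .
  then show ?thesis unfolding copy_def by blast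
qed

lemma copy_inj: "inj_on copy (Collect valid)"
proof (rule inj_onI)
  fix L M assume "L \<in> Collect valid" "M \<in> Collect valid" "copy L = copy M"
  moreover from this obtain e where "e \<in> copy L" "e \<in> copy M" using copy_nonempty by blast
  ultimately show "L = M" using copy_eqI[of L M e e] by (simp add: lobe_rel_def)
qed

lemma tree_edges: "e \<in> edges tree_adj \<longleftrightarrow> (\<exists>L. valid L \<and> e \<in> copy L)"
  unfolding edges_def tree_adj_def copy_def by blast

lemma tree_lobes: "lobes tree_adj = copy ` Collect valid"
proof -
  have *: "{e' \<in> edges tree_adj. lobe_rel tree_adj e e'} = copy L" if "valid L" "e \<in> copy L" for L e
    using that copy_eqI[OF that(1) _ that(2)] copy_lobe_rel[OF that] tree_edges by blast
  show ?thesis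
  proof
    show "lobes tree_adj \<subseteq> copy ` Collect valid"
      unfolding lobes_def using * tree_edges by blast
    show "copy ` Collect valid \<subseteq> lobes tree_adj"
    proof
      fix C assume "C \<in> copy ` Collect valid"
      then obtain L where L: "valid L" "C = copy L" by blast
      obtain e where e: "e \<in> copy L" using copy_nonempty by blast
      with L *[OF L(1) e] tree_edges show "C \<in> lobes tree_adj" unfolding lobes_def by blast
    qed
  qed
qed

section \<open>Parametrizing and counting the lobes of the tree\<close>

definition tree_iso :: "nat set set \<Rightarrow> 'a \<Rightarrow> nat" where
  "tree_iso C = pos (inv_into (Collect valid) copy C)"

lemma tree_iso_copy: "valid L \<Longrightarrow> tree_iso (copy L) = pos L"
  unfolding tree_iso_def using inv_into_f_f[OF copy_inj, of L] by simp

lemma copy_verts: "lobe_verts (copy L) = pos L ` V0"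
proof
  show "lobe_verts (copy L) \<subseteq> pos L ` V0"
    unfolding lobe_verts_def copy_def using E0D by blast
  show "pos L ` V0 \<subseteq> lobe_verts (copy L)"
  proof
    fix u assume "u \<in> pos L ` V0"
    then obtain x where x: "x \<in> V0" "u = pos L x" by blast
    obtain y where "E0 x y" using neighbour[OF x(1)] .
    then show "u \<in> lobe_verts (copy L)" unfolding lobe_verts_def copy_def x(2) by blast
  qed
qed

lemma copy_iso:
  assumes L: "valid L"
  shows "graph_iso V0 E0 (lobe_verts (copy L)) (lobe_adj (copy L)) (pos L)"
  unfolding graph_iso_def
proof (intro conjI ballI)
  show "bij_betw (pos L) V0 (lobe_verts (copy L))"
    unfolding copy_verts using pos_inj[OF L] by (rule inj_on_imp_bij_betw)
  fix x y assume xy: "x \<in> V0" "y \<in> V0"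
  show "E0 x y \<longleftrightarrow> lobe_adj (copy L) (pos L x) (pos L y)"
  proof
    assume "E0 x y"
    then show "lobe_adj (copy L) (pos L x) (pos L y)" unfolding lobe_adj_def copy_def by blast
  next
    assume "lobe_adj (copy L) (pos L x) (pos L y)"
    then obtain x' y' where x': "E0 x' y'" "{pos L x, pos L y} = {pos L x', pos L y'}"
      unfolding lobe_adj_def copy_def by blast
    then have "x = x' \<and> y = y' \<or> x = y' \<and> y = x'"
      using xy E0D[OF x'(1)] inj_on_eq_iff[OF pos_inj[OF L]] by (simp add: doubleton_eq_iff)
    then show "E0 x y" using x'(1) E0D by blast
  qed
qed

text \<open>At a vertex with normal form \<open>(M, y)\<close> the lobes correspond to the slots of
  \<open>y\<close>, and those that meet it in the orbit of \<open>a\<close> to the slots labelled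
  \<open>rep a\<close>.\<close>

lemma tree_count:
  assumes L: "valid L" and x: "x \<in> V0" and a: "a \<in> V0"
  shows "ecard {C \<in> lobes tree_adj. pos L x \<in> tree_iso C ` orb a} = m x a"
proof -
  obtain M y where My: "(M, y) \<in> nodes" "pos L x = pos M y" using pos_node L x .
  note M = nodesD[OF My(1)]
  define b where "b = rep a"
  have b: "b \<in> rep ` V0" "b \<in> V0" "rep b = b" "orb a = orb b"
    using a rep_V0 orb_rep unfolding b_def by auto
  \<comment> \<open>If \<open>L\<close> is a child of \<open>M\<close>, then \<open>x\<close> is its
    position of attachment, and \<open>slots_m\<close> compares the numbers at \<open>x\<close> and
    \<open>y\<close>.\<close>
  have "m y b = m x b"
    using pos_eq_node[OF L x My] L slots_m[of y x] M by fastforce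
  also have "m x b = m x a" using m_orb_right rep_orb a unfolding b_def .
  finally have mb: "m y b = m x a" .
  \<comment> \<open>In the orbit of \<open>y\<close> itself, number 0 stands for \<open>M\<close>,
    which is reached without a further step.\<close>
  define idx where "idx n = (if (b, n) = (rep y, 0) then M else (y, b, n) # M)" for n :: nat
  have idx_valid: "valid (idx n)" if "enat n < m y b" for n
    using that M b unfolding idx_def by (auto simp: slots_def)
  have "{C \<in> lobes tree_adj. pos L x \<in> tree_iso C ` orb a} = (\<lambda>n. copy (idx n)) ` {n. enat n < m y b}"
    (is "?A = ?B")
  proof (intro equalityI subsetI)
    fix C assume "C \<in> ?A"
    then obtain L' z where L': "valid L'" "C = copy L'" "z \<in> orb b" "pos L' z = pos M y"
      using My(2) b(4) tree_iso_copy unfolding tree_lobes by auto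
    have rz: "rep z = b" "z \<in> V0" using rep_eq[OF L'(3)] b orb_in[OF L'(3)] by simp_all
    from pos_eq_node[OF L'(1) rz(2) My(1) L'(4)]
    show "C \<in> ?B"
    proof
      assume "L' = M \<and> z = y"
      then have "L' = idx 0" "enat 0 < m y b" using rz slots_self[of y] M by (auto simp: idx_def slots_def)
      with L' show ?thesis by blast
    next
      assume "\<exists>n. L' = (y, z, n) # M"
      then obtain n where n: "L' = (y, z, n) # M" by blast
      with L'(1) have "(z, n) \<in> slots y" "(z, n) \<noteq> (rep y, 0)" by auto
      \<comment> \<open>Children are attached at representatives, so \<open>z\<close> is not just in
        the orbit of \<open>b\<close> but equal to it.\<close>
      moreover from this rz slotsD have "z = b" by metis
      ultimately have "L' = idx n" "enat n < m y b" using n slotsD by (auto simp: idx_def)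
      with L' show ?thesis by blast
    qed
  next
    fix C assume "C \<in> ?B"
    then obtain n where n: "enat n < m y b" "C = copy (idx n)" by blast
    have "pos M y \<in> pos (idx n) ` orb b"
    proof (cases "(b, n) = (rep y, 0)")
      case True
      then have "y \<in> orb b" using rep_eq_iff[of y b] b by auto
      with True show ?thesis by (simp add: idx_def)
    next
      case False
      then have i: "idx n = (y, b, n) # M" by (simp only: idx_def if_False)
      then have "pos (idx n) b = pos M y" using pos_parent idx_valid[OF n(1)] by simp
      then show ?thesis using orb_self by (metis image_eqI)
    qed
    then show "C \<in> ?A" using n idx_valid tree_iso_copy My(2) b(4) unfolding tree_lobes by simp
  qed
  moreover have "inj_on (\<lambda>n. copy (idx n)) {n. enat n < m y b}"
  proof (rule inj_onI)
    fix i j assume ij: "i \<in> {n. enat n < m y b}" "j \<in> {n. enat n < m y b}" "copy (idx i) = copy (idx j)"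
    then have "idx i = idx j" using inj_onD[OF copy_inj ij(3)] idx_valid by simp
    then show "i = j" unfolding idx_def by (auto split: if_splits)
  qed
  ultimately show ?thesis using ecard_image ecard_enat_less mb by metis
qed

text \<open>Makes the tree one of the graphs that it covers; its automorphisms come from
  this.\<close>

lemma tree_lobe_graph: "lobe_graph V0 E0 H m tree_verts tree_adj tree_iso"
proof unfold_locales
  show "simple_graph tree_verts tree_adj" "connected_in tree_verts tree_adj"
    by (fact simple_tree connected_tree)+
  fix C assume "C \<in> lobes tree_adj"
  then obtain L where L: "valid L" "C = copy L" unfolding tree_lobes by blast
  then show "graph_iso V0 E0 (lobe_verts C) (lobe_adj C) (tree_iso C)"
    using copy_iso tree_iso_copy by simp
  fix x a assume "x \<in> V0" "a \<in> V0"
  then show "ecard {C' \<in> lobes tree_adj. tree_iso C x \<in> tree_iso C' ` orb a} = m x a"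
    using tree_count L tree_iso_copy by simp
qed simp

text \<open>The further slot holds a child of the root at \<open>x\<close>; this child and the other
  positions of the root lie on different sides of the shared vertex.\<close>

lemma tree_connectivity_one:
  assumes x: "x \<in> V0" and s: "(a, n) \<in> slots x" "(a, n) \<noteq> (rep x, 0)"
  shows "connectivity_one tree_verts tree_adj"
proof -
  let ?L = "[(x, a, n)]" and ?v = "pos [] x"
  have L: "valid ?L" using x s by simp
  obtain y where y: "y \<in> V0" "y \<noteq> x" using other_vertex .
  obtain z where z: "z \<in> V0" "z \<noteq> a" using other_vertex .
  have p: "pos [] y \<in> tree_verts" "pos ?L z \<in> tree_verts" "?v \<in> tree_verts"
    unfolding tree_verts_def using y z x L valid.simps(1) by blast+
  have yb: "pos [] y \<notin> below ?L" using y by (simp add: pos_below)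
  have zb: "pos ?L z \<in> below ?L" using z L by (subst pos_below) auto
  have vb: "?v \<notin> below ?L" using parent_not_below[OF L] .
  have yv: "pos [] y \<noteq> ?v" using inj_on_eq_iff[OF pos_inj[of "[]"]] x y by simp
  have "\<not> connected_in (tree_verts - {?v}) tree_adj"
  proof
    assume "connected_in (tree_verts - {?v}) tree_adj"
    moreover have "pos ?L z \<in> tree_verts - {?v}" "pos [] y \<in> tree_verts - {?v}"
      using p zb vb yv by auto
    ultimately have "(avoiding tree_adj ?v)\<^sup>*\<^sup>* (pos ?L z) (pos [] y)"
      by (rule connected_avoiding)
    then have "pos [] y \<in> below ?L"
    proof (induction rule: rtranclp_induct)
      case (step u w)
      then show ?case using below_edge[of u w x a n "[]"] by simp
    qed (rule zb)
    with yb show False ..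
  qed
  then show ?thesis
    unfolding connectivity_one_def using connected_tree p yv by blast
qed

end

section \<open>Unfolding a graph into the tree of lobes\<close>

text \<open>The value at 0 can be prescribed because slot \<open>(rep y, 0)\<close> has to be the
  lobe one comes from.\<close>

lemma ex_enumeration:
  assumes "countable S"
  obtains g where "bij_betw g {n. enat n < ecard S} S" "c \<in> S \<Longrightarrow> g 0 = c"
proof -
  let ?I = "{n. enat n < ecard S}"
  obtain g where g: "bij_betw g ?I S"
  proof (cases "finite S")
    case True
    then have "?I = {0..<card S}" by (auto simp: ecard_def)
    with ex_bij_betw_nat_finite[OF True] that show thesis by metis
  next
    case False
    then have "?I = UNIV" by (auto simp: ecard_def)
    with bij_betw_from_nat_into[OF assms False] that show thesis by metis
  qed
  show thesis
  proof (cases "c \<in> S")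
    case True
    with g obtain i where i: "i \<in> ?I" "g i = c" by (metis bij_betw_imp_surj_on imageE)
    define t where "t n = (if n = 0 then i else if n = i then 0 else n)" for n :: nat
    have "0 \<in> ?I" using i(1) by (metis (mono_tags) enat_0 gr_implies_not_zero mem_Collect_eq zero_less_iff_neq_zero)
    then have "bij_betw t ?I ?I"
      using i(1) by (intro bij_betw_byWitness[of _ t]) (auto simp: t_def)
    then have "bij_betw (g \<circ> t) ?I S" using g by (rule bij_betw_trans)
    moreover have "(g \<circ> t) 0 = c" using i(2) by (simp add: t_def)
    ultimately show thesis using that by blast
  qed (use g that in blast)
qed

section \<open>Walks in the tree\<close>

context lobe_pattern
begin

definition lobe_at :: "('a \<times> 'a \<times> nat) list \<Rightarrow> 'a \<Rightarrow> 'a \<times> nat \<Rightarrow> ('a \<times> 'a \<times> nat) list" where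
  "lobe_at M y s = (if s = (rep y, 0) then M else (y, s) # M)"

lemma lobe_at_valid:
  assumes "(M, y) \<in> nodes" "s \<in> slots y"
  shows "valid (lobe_at M y s)"
  using assms by (cases s) (auto simp: lobe_at_def nodes_def)

lemma lobe_at_cases:
  assumes L: "valid L" "x \<in> V0" and M: "(M, y) \<in> nodes" and eq: "pos L x = pos M y"
  obtains s where "s \<in> slots y" "L = lobe_at M y s"
  using pos_eq_node[OF assms]
proof
  assume "L = M \<and> x = y"
  then show thesis using that[of "(rep y, 0)"] slots_self nodesD[OF M] by (simp add: lobe_at_def)
next
  assume "\<exists>n. L = (y, x, n) # M"
  then obtain n where "L = (y, x, n) # M" by blast
  with L(1) show thesis using that[of "(x, n)"] by (simp add: lobe_at_def)
qed

text \<open>Walks through the tree that never stay in a lobe: such a walk cannot return to its start.\<close>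

inductive chain :: "nat \<Rightarrow> ('a \<times> 'a \<times> nat) list \<Rightarrow> nat \<Rightarrow> bool" where
  direct: "valid L \<Longrightarrow> x \<in> V0 \<Longrightarrow> y \<in> V0 \<Longrightarrow> x \<noteq> y \<Longrightarrow> chain (pos L x) L (pos L y)"
| step: "valid L \<Longrightarrow> x \<in> V0 \<Longrightarrow> y \<in> V0 \<Longrightarrow> x \<noteq> y \<Longrightarrow> L \<noteq> L' \<Longrightarrow> chain (pos L y) L' w \<Longrightarrow>
    chain (pos L x) L w"

lemma chain_start: "chain u L w \<Longrightarrow> valid L \<and> (\<exists>x\<in>V0. u = pos L x)"
  by (induction rule: chain.induct) auto

text \<open>A step inside \<open>L\<close> merges with a first step that is also in
  \<open>L\<close>. If the merged step would return to \<open>pos L x\<close>, it is dropped and the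
  tail remains, so the first lobe can change; \<open>w \<noteq> pos L x\<close> ensures that a tail
  exists.\<close>

lemma chain_extend:
  assumes ch: "chain u' L' w" and L: "valid L" "x \<in> V0" "y \<in> V0" "x \<noteq> y" and u': "u' = pos L y"
    and w: "w \<noteq> pos L x"
  shows "\<exists>M. chain (pos L x) M w"
proof (cases "L' = L")
  case False
  then show ?thesis using chain.step[OF L, of L' w] ch u' by blast
next
  case True
  from ch show ?thesis
  proof cases
    case (direct x1 y1)
    then show ?thesis using chain.direct[of L x y1] L w True by blast
  next
    case (step x1 y1 L'')
    then show ?thesis
      using chain.step[of L x y1 L'' w] L True by (cases "x = y1") auto
  qed
qed

lemma ex_chain:
  assumes "u \<in> tree_verts" "w \<in> tree_verts" "u \<noteq> w"
  shows "\<exists>L. chain u L w"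
proof -
  have "(\<lambda>u w. tree_adj u w \<and> u \<in> tree_verts \<and> w \<in> tree_verts)\<^sup>*\<^sup>* u w"
    using connected_tree assms unfolding connected_in_def by blast
  then have "u = w \<or> (\<exists>L. chain u L w)"
  proof (induction rule: converse_rtranclp_induct)
    case (step u u')
    then obtain L x y where L: "valid L" "E0 x y" "u = pos L x" "u' = pos L y"
      unfolding tree_adj_def by blast
    note xy = E0D[OF L(2)]
    show ?case
    proof (cases "u' = w")
      case True
      then show ?thesis using chain.direct[OF L(1), of x y] xy L by blast
    next
      case False
      then show ?thesis using step.IH chain_extend[of u' _ w L x y] xy L by blast
    qed
  qed simp
  with assms(3) show ?thesis by blast
qed

end

section \<open>Lobes around a vertex of a given graph\<close>

context lobe_graph
begin

lemma countable_lobes: "countable (lobes E)"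
proof -
  have "edges E \<subseteq> (\<lambda>(u, w). {u, w}) ` (V \<times> V)"
    unfolding edges_def using ED by auto
  then have "countable (edges E)" using countable_V by (meson countable_SIGMA countable_image countable_subset)
  moreover have "lobes E = (\<lambda>e. {e' \<in> edges E. lobe_rel E e e'}) ` edges E" unfolding lobes_def by blast
  ultimately show ?thesis by simp
qed

definition slot_enum :: "'v set set \<Rightarrow> 'a \<Rightarrow> ('a \<times> nat \<Rightarrow> 'v set set) \<Rightarrow> bool" where
  "slot_enum C y \<beta> \<longleftrightarrow> bij_betw \<beta> (slots y) {D \<in> lobes E. \<sigma> C y \<in> lobe_verts D} \<and>
     \<beta> (rep y, 0) = C \<and> (\<forall>(a, n) \<in> slots y. \<sigma> C y \<in> \<sigma> (\<beta> (a, n)) ` orb a)"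

text \<open>For each orbit there are as many lobes as slots. The separate enumerations fit together
  because a lobe meets a vertex in only one position, hence in only one orbit.\<close>

lemma ex_slot_enum:
  assumes C: "C \<in> lobes E" and y: "y \<in> V0"
  shows "\<exists>\<beta>. slot_enum C y \<beta>"
proof -
  define S where "S a = {D \<in> lobes E. \<sigma> C y \<in> \<sigma> D ` orb a}" for a
  have "\<exists>g. bij_betw g {n. enat n < ecard (S a)} (S a) \<and> (C \<in> S a \<longrightarrow> g 0 = C)" for a
  proof -
    have "countable (S a)" using countable_lobes by (rule countable_subset[rotated]) (auto simp: S_def)
    then show ?thesis by (rule ex_enumeration[of "S a" C]) blast
  qed
  then obtain G where G: "\<And>a. bij_betw (G a) {n. enat n < ecard (S a)} (S a)"
    "\<And>a. C \<in> S a \<Longrightarrow> G a 0 = C" by metis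
  have Sm: "ecard (S a) = m y a" if "a \<in> V0" for a
    using lobe_count[OF C y that] unfolding S_def .
  have bij: "bij_betw (G a) {n. enat n < m y a} (S a)" if "a \<in> V0" for a
    using G(1)[of a] Sm[OF that] by simp
  define \<beta> where "\<beta> = (\<lambda>(a, n). G a n)"
  have in_S: "\<beta> (a, n) \<in> S a" if "(a, n) \<in> slots y" for a n
    using bij_betwE[OF bij[of a]] slotsD[OF that] by (simp add: \<beta>_def)
  have disj: "a = b" if D: "D \<in> S a" "D \<in> S b" and ab: "a \<in> V0" "rep a = a" "b \<in> V0" "rep b = b" for D a b
  proof -
    obtain z z' where z: "z \<in> orb a" "z' \<in> orb b" "\<sigma> C y = \<sigma> D z" "\<sigma> C y = \<sigma> D z'"
      using D unfolding S_def by blast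
    have "D \<in> lobes E" using D unfolding S_def by blast
    then have "z = z'" using sigma_inj z ab orb_in by (metis inj_on_eq_iff)
    then show ?thesis using rep_eq z ab by metis
  qed
  have "inj_on \<beta> (slots y)"
  proof (rule inj_onI)
    fix s t assume st: "s \<in> slots y" "t \<in> slots y" "\<beta> s = \<beta> t"
    obtain a i b j where s: "s = (a, i)" "t = (b, j)" by fastforce
    note sl = slotsD[OF st(1)[unfolded s]] slotsD[OF st(2)[unfolded s]]
    have "\<beta> s \<in> S a" using in_S[of a i] st(1) s by simp
    moreover have "\<beta> s \<in> S b" using in_S[of b j] st(2,3) s by simp
    ultimately have "a = b" using disj[of "\<beta> s" a b] sl by blast
    have "i = j"
      using st(3) sl bij_betw_imp_inj_on[OF bij[of a]] \<open>a = b\<close> unfolding s \<beta>_def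
      by (auto dest: inj_onD)
    with \<open>a = b\<close> show "s = t" using s by simp
  qed
  moreover have "\<beta> ` slots y = {D \<in> lobes E. \<sigma> C y \<in> lobe_verts D}"
  proof (intro equalityI subsetI)
    fix D assume "D \<in> \<beta> ` slots y"
    then obtain a n where "D = \<beta> (a, n)" "(a, n) \<in> slots y" by auto
    with in_S slotsD have "D \<in> S a" "a \<in> V0" by blast+
    then show "D \<in> {D \<in> lobes E. \<sigma> C y \<in> lobe_verts D}"
      using orb_in sigma_verts[of D] unfolding S_def by blast
  next
    fix D assume D: "D \<in> {D \<in> lobes E. \<sigma> C y \<in> lobe_verts D}"
    then obtain z where z: "z \<in> V0" "\<sigma> C y = \<sigma> D z" using sigma_verts[of D] by blast
    then have "D \<in> S (rep z)" using D orb_rep orb_self unfolding S_def by auto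
    then have "D \<in> G (rep z) ` {n. enat n < m y (rep z)}"
      using bij_betw_imp_surj_on[OF bij[OF rep_V0[OF z(1)]]] by simp
    then obtain n where "enat n < m y (rep z)" "G (rep z) n = D" by blast
    then show "D \<in> \<beta> ` slots y"
      using z(1) by (intro image_eqI[of _ _ "(rep z, n)"]) (auto simp: \<beta>_def slots_def)
  qed
  moreover have "\<beta> (rep y, 0) = C"
  proof -
    have "C \<in> S (rep y)" using C orb_rep orb_self unfolding S_def by auto
    then show ?thesis using G(2) by (simp add: \<beta>_def)
  qed
  moreover have "\<forall>(a, n) \<in> slots y. \<sigma> C y \<in> \<sigma> (\<beta> (a, n)) ` orb a"
    using in_S unfolding S_def by blast
  ultimately show ?thesis unfolding slot_enum_def bij_betw_def by blast
qed

definition slot_lobe :: "'v set set \<Rightarrow> 'a \<Rightarrow> 'a \<times> nat \<Rightarrow> 'v set set" where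
  "slot_lobe C y = (SOME \<beta>. slot_enum C y \<beta>)"

lemma slot_lobe:
  assumes "C \<in> lobes E" "y \<in> V0"
  shows "bij_betw (slot_lobe C y) (slots y) {D \<in> lobes E. \<sigma> C y \<in> lobe_verts D}"
    "slot_lobe C y (rep y, 0) = C"
    "(a, n) \<in> slots y \<Longrightarrow> \<sigma> C y \<in> \<sigma> (slot_lobe C y (a, n)) ` orb a"
proof -
  have "slot_enum C y (slot_lobe C y)"
    unfolding slot_lobe_def using ex_slot_enum[OF assms] by (rule someI_ex)
  then show "bij_betw (slot_lobe C y) (slots y) {D \<in> lobes E. \<sigma> C y \<in> lobe_verts D}"
    "slot_lobe C y (rep y, 0) = C"
    "(a, n) \<in> slots y \<Longrightarrow> \<sigma> C y \<in> \<sigma> (slot_lobe C y (a, n)) ` orb a"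
    unfolding slot_enum_def by auto
qed

text \<open>The image of a lobe of the tree, and the element of \<open>H\<close> by which its parametrization by
  \<open>V0\<close> differs from \<open>\<sigma>\<close>.\<close>

fun develop :: "'v set set \<Rightarrow> ('a \<times> 'a \<times> nat) list \<Rightarrow> 'v set set \<times> ('a \<Rightarrow> 'a)" where
  "develop C0 [] = (C0, id)"
| "develop C0 ((x, s) # L) =
     (let C = fst (develop C0 L); y = snd (develop C0 L) x; D = slot_lobe C y s
      in (D, SOME h. h \<in> H \<and> \<sigma> D (h (fst s)) = \<sigma> C y))"

end

section \<open>The covering map from the tree\<close>

locale rooted_lobe_graph = lobe_graph V0 E0 H m V E \<sigma>
  for V0 :: "'a set" and E0 :: "'a \<Rightarrow> 'a \<Rightarrow> bool" and H :: "('a \<Rightarrow> 'a) set"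
    and m :: "'a \<Rightarrow> 'a \<Rightarrow> enat"
    and V :: "'v set" and E :: "'v \<Rightarrow> 'v \<Rightarrow> bool" and \<sigma> :: "'v set set \<Rightarrow> 'a \<Rightarrow> 'v" +
  fixes C0 :: "'v set set"
  assumes root: "C0 \<in> lobes E"
begin

abbreviation im :: "('a \<times> 'a \<times> nat) list \<Rightarrow> 'v set set" where
  "im L \<equiv> fst (develop C0 L)"

abbreviation twist :: "('a \<times> 'a \<times> nat) list \<Rightarrow> 'a \<Rightarrow> 'a" where
  "twist L \<equiv> snd (develop C0 L)"

definition par :: "('a \<times> 'a \<times> nat) list \<Rightarrow> 'a \<Rightarrow> 'v" where
  "par L x = \<sigma> (im L) (twist L x)"

text \<open>The twist moves \<open>x\<close> within its orbit and so keeps its slots. The new lobe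
  meets the vertex in the orbit of \<open>a\<close>; an element of \<open>H\<close> that takes
  \<open>a\<close> to this position aligns the two lobes.\<close>

lemma develop_step:
  assumes L: "im L \<in> lobes E" "twist L \<in> H" and x: "x \<in> V0" and s: "(a, n) \<in> slots x"
  shows "im ((x, a, n) # L) \<in> lobes E" "twist ((x, a, n) # L) \<in> H" "par ((x, a, n) # L) a = par L x"
proof -
  define y where "y = twist L x"
  define D where "D = slot_lobe (im L) y (a, n)"
  have y: "y \<in> V0" "y \<in> orb x" using H_in L(2) x unfolding y_def orb_def by auto
  have s': "(a, n) \<in> slots y" using slots_orb y x s by simp
  have D: "D \<in> lobes E" "\<sigma> (im L) y \<in> \<sigma> D ` orb a"
    using bij_betwE[OF slot_lobe(1)[OF L(1) y(1)]] slot_lobe(3)[OF L(1) y(1) s'] s' unfolding D_def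
    by blast+
  then have "\<exists>h. h \<in> H \<and> \<sigma> D (h a) = \<sigma> (im L) y" unfolding orb_def by force
  then have "(SOME h. h \<in> H \<and> \<sigma> D (h a) = \<sigma> (im L) y) \<in> H \<and>
      \<sigma> D ((SOME h. h \<in> H \<and> \<sigma> D (h a) = \<sigma> (im L) y) a) = \<sigma> (im L) y" by (rule someI_ex)
  moreover have "develop C0 ((x, a, n) # L) = (D, SOME h. h \<in> H \<and> \<sigma> D (h a) = \<sigma> (im L) y)"
    by (simp add: Let_def D_def y_def)
  ultimately show "im ((x, a, n) # L) \<in> lobes E" "twist ((x, a, n) # L) \<in> H"
    "par ((x, a, n) # L) a = par L x"
    using D(1) unfolding par_def y_def by simp_all
qed

lemma develop_valid:
  assumes "valid L"
  shows "im L \<in> lobes E" "twist L \<in> H"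
proof -
  have "im L \<in> lobes E \<and> twist L \<in> H" using assms
  proof (induction L rule: valid.induct)
    case (2 x a n L)
    then show ?case using develop_step(1,2)[of L x a n] by simp
  qed (simp_all add: root id_H)
  then show "im L \<in> lobes E" "twist L \<in> H" by auto
qed

lemma par_parent: "valid ((x, a, n) # L) \<Longrightarrow> par ((x, a, n) # L) a = par L x"
  using develop_step(3)[OF develop_valid] by simp

text \<open>Identified positions share a normal form at most one step up, where
  \<open>par_parent\<close> compares them. Hence \<open>par\<close> descends to vertices.\<close>

lemma par_cong:
  assumes L: "valid L" "x \<in> V0" and M: "valid M" "y \<in> V0" and eq: "pos L x = pos M y"
  shows "par L x = par M y"
proof -
  obtain N z where N: "(N, z) \<in> nodes" "pos L x = pos N z" using pos_node L .
  have "par L x = par N z" using pos_eq_node[OF L N] L(1) par_parent by blast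
  moreover have "par M y = par N z"
    using pos_eq_node[OF M N(1)] N(2) eq M(1) par_parent by metis
  ultimately show ?thesis by simp
qed

lemma par_verts: "valid L \<Longrightarrow> par L ` V0 = lobe_verts (im L)"
  using sigma_verts[of "im L"] develop_valid[of L] bij_betw_imp_surj_on[OF H_bij, of "twist L"]
  unfolding par_def by (metis image_image)

lemma par_inj: "valid L \<Longrightarrow> inj_on (par L) V0"
  using sigma_inj[of "im L"] develop_valid[of L] H_bij[of "twist L"] comp_inj_on
  unfolding par_def bij_betw_def comp_def by metis

lemma par_in: "valid L \<Longrightarrow> x \<in> V0 \<Longrightarrow> par L x \<in> lobe_verts (im L)"
  using par_verts by blast

lemma par_neq: "valid L \<Longrightarrow> x \<in> V0 \<Longrightarrow> y \<in> V0 \<Longrightarrow> x \<noteq> y \<Longrightarrow> par L y \<noteq> par L x"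
  using inj_on_eq_iff[OF par_inj, of L y x] by simp

lemma par_adj: "valid L \<Longrightarrow> x \<in> V0 \<Longrightarrow> y \<in> V0 \<Longrightarrow> {par L x, par L y} \<in> im L \<longleftrightarrow> E0 x y"
  using sigma_adj[of "im L" "twist L x" "twist L y"] develop_valid[of L] H_in[of "twist L"] H_E0[of "twist L"]
  unfolding par_def by simp

text \<open>Local bijectivity of the covering. The twist keeps \<open>y\<close> in its orbit, so the
  slots and the reserved slot are those of \<open>y\<close>.\<close>

lemma lobes_at:
  assumes "(M, y) \<in> nodes"
  shows "bij_betw (\<lambda>s. im (lobe_at M y s)) (slots y) {D \<in> lobes E. par M y \<in> lobe_verts D}"
proof -
  note M = nodesD[OF assms]
  note d = develop_valid[of M]
  have ty: "twist M y \<in> V0" "twist M y \<in> orb y" using M d H_in unfolding orb_def by auto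
  have "im (lobe_at M y s) = slot_lobe (im M) (twist M y) s" for s
    using slot_lobe(2)[OF _ ty(1), of "im M"] d M rep_eq[OF ty(2)]
    by (auto simp: lobe_at_def Let_def)
  then show ?thesis
    using slot_lobe(1)[OF _ ty(1), of "im M"] d M slots_orb[OF ty(2)] unfolding par_def by simp
qed

definition cover :: "nat \<Rightarrow> 'v" where
  "cover v = (case SOME p. valid (fst p) \<and> snd p \<in> V0 \<and> v = pos (fst p) (snd p) of (L, x) \<Rightarrow> par L x)"

lemma cover_pos:
  assumes "valid L" "x \<in> V0"
  shows "cover (pos L x) = par L x"
proof -
  let ?P = "\<lambda>p. valid (fst p) \<and> snd p \<in> V0 \<and> pos L x = pos (fst p) (snd p)"
  have "?P (L, x)" using assms by simp
  then have "?P (Eps ?P)" by (rule someI)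
  then show ?thesis unfolding cover_def using par_cong[OF _ _ assms] by (auto simp: case_prod_beta)
qed

lemma lobe_covered:
  assumes L: "valid L" "x \<in> V0" and D: "D \<in> lobes E" "par L x \<in> lobe_verts D"
  obtains M where "valid M" "im M = D"
proof -
  obtain N z where N: "(N, z) \<in> nodes" "pos L x = pos N z" using pos_node L .
  then have "par L x = par N z" using par_cong L nodesD by blast
  with D have "D \<in> (\<lambda>s. im (lobe_at N z s)) ` slots z"
    using bij_betw_imp_surj_on[OF lobes_at[OF N(1)]] by simp
  then show thesis using that lobe_at_valid[OF N(1)] by blast
qed

text \<open>Local injectivity: a change of lobe along a chain remains one in the image.\<close>

lemma im_neq:
  assumes L: "valid L" "x \<in> V0" and M: "valid M" "y \<in> V0" and eq: "pos L x = pos M y" and "L \<noteq> M"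
  shows "im L \<noteq> im M"
proof -
  obtain N z where N: "(N, z) \<in> nodes" "pos L x = pos N z" using pos_node L .
  obtain s where s: "s \<in> slots z" "L = lobe_at N z s" using lobe_at_cases[OF L N] .
  obtain t where t: "t \<in> slots z" "M = lobe_at N z t" using lobe_at_cases[OF M N(1)] N(2) eq by metis
  show ?thesis
    using inj_onD[OF bij_betw_imp_inj_on[OF lobes_at[OF N(1)]], of s t] s t \<open>L \<noteq> M\<close> by blast
qed

text \<open>Every turn enters a different lobe of the graph, so \<open>branch_chain\<close> keeps
  the end of the chain in the branch at its start; a branch at a vertex omits that vertex.\<close>

lemma chain_branch: "chain u L w \<Longrightarrow> cover w \<in> branch (im L) (cover u)"
proof (induction rule: chain.induct)
  case (direct L x y)
  have "par L y \<in> branch (im L) (par L x)"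
    by (rule lobe_branch) (use direct develop_valid par_in par_neq in simp_all)
  then show ?case using cover_pos direct by simp
next
  case (step L x y L' w)
  obtain z where z: "valid L'" "z \<in> V0" "pos L y = pos L' z" using chain_start step.hyps(6) by blast
  have ne: "im L \<noteq> im L'" using im_neq[OF step.hyps(1,3) z step.hyps(5)] .
  have "cover w \<in> branch (im L') (par L y)" using step.IH cover_pos step.hyps(1,3) by simp
  then have "cover w \<in> branch (im L) (par L x)"
    by (rule branch_chain[OF _ _ ne, rotated -1])
      (use step.hyps z(1) develop_valid par_in par_neq in simp_all)
  then show ?case using cover_pos step.hyps(1,2) by simp
qed

lemma cover_inj: "inj_on cover tree_verts"
proof (rule inj_onI, rule ccontr)
  fix u w assume uw: "u \<in> tree_verts" "w \<in> tree_verts" "cover u = cover w" "u \<noteq> w"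
  then obtain L where "chain u L w" using ex_chain by blast
  then have "valid L" "cover w \<in> branch (im L) (cover u)" using chain_start chain_branch by blast+
  then show False using branch_neq develop_valid(1) uw(3) by metis
qed

lemma cover_surj: "cover ` tree_verts = V"
proof
  have cov: "cover ` tree_verts = {par L x | L x. valid L \<and> x \<in> V0}"
    unfolding tree_verts_def using cover_pos by (auto simp: image_iff) metis+
  show "cover ` tree_verts \<subseteq> V"
    unfolding cov using par_verts lobe_verts_V develop_valid(1) by blast
  obtain r where r: "r \<in> V0" using other_vertex .
  \<comment> \<open>All lobes at a covered vertex are images of lobes of the tree, so its neighbours
    are covered too.\<close>
  show "V \<subseteq> cover ` tree_verts"
  proof (rule connected_in_closed[OF connected_G])
    show "par [] r \<in> cover ` tree_verts" unfolding cov using r valid.simps(1) by blast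
    then show "par [] r \<in> V" using \<open>cover ` tree_verts \<subseteq> V\<close> by blast
  next
    fix v w assume v: "v \<in> cover ` tree_verts" and "E v w"
    then obtain D where D: "D \<in> lobes E" "{v, w} \<in> D" using ex_lobe by blast
    then have vw: "v \<in> lobe_verts D" "w \<in> lobe_verts D" unfolding lobe_verts_def by auto
    obtain L x where "valid L" "x \<in> V0" "v = par L x" using v unfolding cov by blast
    then obtain M where "valid M" "im M = D" using lobe_covered D(1) vw(1) by blast
    then show "w \<in> cover ` tree_verts" unfolding cov using par_verts vw(2) by blast
  qed
qed

lemma cover_adj:
  assumes "u \<in> tree_verts" "w \<in> tree_verts"
  shows "tree_adj u w \<longleftrightarrow> E (cover u) (cover w)"
proof
  assume "tree_adj u w"
  then obtain L x y where L: "valid L" "E0 x y" "u = pos L x" "w = pos L y"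
    unfolding tree_adj_def by blast
  note xy = E0D[OF L(2)]
  have "{par L x, par L y} \<in> im L" using par_adj L xy by blast
  then show "E (cover u) (cover w)"
    using lobe_E[OF develop_valid(1)[OF L(1)]] cover_pos[OF L(1)] L xy by simp
next
  \<comment> \<open>The lobe of this edge lifts to some \<open>M\<close>; that \<open>u\<close> and
    \<open>w\<close> themselves are the matching vertices of \<open>M\<close> follows from
    injectivity.\<close>
  assume "E (cover u) (cover w)"
  then obtain D where D: "D \<in> lobes E" "{cover u, cover w} \<in> D" using ex_lobe by blast
  obtain L x where "valid L" "x \<in> V0" "u = pos L x" using assms(1) unfolding tree_verts_def by blast
  moreover have "cover u \<in> lobe_verts D" using D(2) unfolding lobe_verts_def by auto
  ultimately obtain M where M: "valid M" "im M = D" using lobe_covered[of L x D] D(1) cover_pos by auto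
  then have "cover u \<in> par M ` V0" "cover w \<in> par M ` V0"
    using par_verts D(2) unfolding lobe_verts_def by auto
  then obtain y z where yz: "y \<in> V0" "z \<in> V0" "cover u = par M y" "cover w = par M z" by blast
  then have "E0 y z" using par_adj M D(2) by metis
  have "pos M y \<in> tree_verts" "pos M z \<in> tree_verts"
    using M(1) yz(1,2) unfolding tree_verts_def by blast+
  then have "u = pos M y" "w = pos M z"
    using yz assms inj_onD[OF cover_inj, of u "pos M y"] inj_onD[OF cover_inj, of w "pos M z"]
      cover_pos[OF M(1)] by simp_all
  with \<open>E0 y z\<close> show "tree_adj u w" using tree_adjI M(1) by blast
qed

lemma cover_iso: "graph_iso tree_verts tree_adj V E cover"
  unfolding graph_iso_def bij_betw_def using cover_inj cover_surj cover_adj by blast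

lemma cover_root: "x \<in> V0 \<Longrightarrow> cover (pos [] x) = \<sigma> C0 x"
  using cover_pos[of "[]" x] by (simp add: par_def)

end

section \<open>Existence and uniqueness\<close>

lemma graph_iso_comp:
  assumes "graph_iso V E V' E' f" "graph_iso V' E' V'' E'' g"
  shows "graph_iso V E V'' E'' (g \<circ> f)"
  using assms bij_betw_trans[of f V V' g V''] bij_betwE[of f V V'] unfolding graph_iso_def by simp

lemma graph_iso_inv:
  assumes "graph_iso V E V' E' f"
  shows "graph_iso V' E' V E (inv_into V f)"
  unfolding graph_iso_def
proof (intro conjI ballI)
  have f: "bij_betw f V V'" "\<And>x y. x \<in> V \<Longrightarrow> y \<in> V \<Longrightarrow> E x y \<longleftrightarrow> E' (f x) (f y)"
    using assms unfolding graph_iso_def by auto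
  then show inv: "bij_betw (inv_into V f) V' V" by (simp add: bij_betw_inv_into)
  fix x y assume "x \<in> V'" "y \<in> V'"
  then show "E' x y \<longleftrightarrow> E (inv_into V f x) (inv_into V f y)"
    using f bij_betwE[OF inv] bij_betw_inv_into_right[OF f(1)] by simp
qed

lemma connectivity_one_edge:
  assumes "connectivity_one V E"
  obtains u w where "E u w"
proof -
  have "\<exists>x\<in>V. \<exists>y\<in>V. x \<noteq> y"
    using assms unfolding connectivity_one_def by (auto simp: card_2_iff)
  then obtain x y where "x \<noteq> y" "(\<lambda>u w. E u w \<and> u \<in> V \<and> w \<in> V)\<^sup>*\<^sup>* x y"
    using assms unfolding connectivity_one_def connected_in_def by blast
  then obtain z where "E x z" by (metis (no_types, lifting) converse_rtranclpE)
  then show thesis by (rule that)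
qed

text \<open>The image of the root copy is recorded because transitivity must control where lobes
  go.\<close>

lemma (in lobe_graph) ex_iso_from_tree:
  assumes C0: "C0 \<in> lobes E"
  obtains F where "graph_iso tree_verts tree_adj V E F" "(\<lambda>e. F ` e) ` copy [] = C0"
proof -
  interpret rooted_lobe_graph V0 E0 H m V E \<sigma> C0
    by unfold_locales (rule C0)
  have "C0 = {{\<sigma> C0 x, \<sigma> C0 y} | x y. E0 x y}"
  proof (intro equalityI subsetI)
    fix e assume e: "e \<in> C0"
    then obtain u w where uw: "e = {u, w}" using lobe_edge_doubleton[OF C0] by metis
    then obtain x y where "E0 x y" "u = \<sigma> C0 x" "w = \<sigma> C0 y"
      using lobe_edge_cases[OF C0] e by metis
    with uw show "e \<in> {{\<sigma> C0 x, \<sigma> C0 y} | x y. E0 x y}" by blast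
  qed (use sigma_edge[OF C0] in auto)
  also have "\<dots> = (\<lambda>e. cover ` e) ` copy []"
  proof -
    have *: "cover ` {pos [] x, pos [] y} = {\<sigma> C0 x, \<sigma> C0 y}" if "E0 x y" for x y
      using E0D[OF that] cover_root by simp
    have "(\<lambda>e. cover ` e) ` copy [] = {cover ` {pos [] x, pos [] y} | x y. E0 x y}"
      unfolding copy_def by blast
    also have "\<dots> = {{\<sigma> C0 x, \<sigma> C0 y} | x y. E0 x y}"
      by (rule Collect_cong) (use * in metis)
    finally show ?thesis ..
  qed
  finally show thesis by (rule that[OF cover_iso sym])
qed

context lobe_pattern
begin

lemma tree_lobe_transitive: "lobe_transitive tree_verts tree_adj"
  unfolding lobe_transitive_def
proof (intro ballI)
  fix C1 C2 assume C: "C1 \<in> lobes tree_adj" "C2 \<in> lobes tree_adj"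
  interpret T: lobe_graph V0 E0 H m tree_verts tree_adj tree_iso
    by (rule tree_lobe_graph)
  obtain f1 where f1: "graph_iso tree_verts tree_adj tree_verts tree_adj f1"
    "(\<lambda>e. f1 ` e) ` copy [] = C1"
    using T.ex_iso_from_tree[OF C(1)] .
  obtain f2 where f2: "graph_iso tree_verts tree_adj tree_verts tree_adj f2"
    "(\<lambda>e. f2 ` e) ` copy [] = C2"
    using T.ex_iso_from_tree[OF C(2)] .
  \<comment> \<open>The identity outside \<open>tree_verts\<close> is the normalization that
    \<open>Aut\<close> demands.\<close>
  define g where "g v = (if v \<in> tree_verts then (f2 \<circ> inv_into tree_verts f1) v else v)" for v
  have "graph_iso tree_verts tree_adj tree_verts tree_adj (f2 \<circ> inv_into tree_verts f1)"
    using graph_iso_comp graph_iso_inv f1(1) f2(1) by metis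
  then have "graph_iso tree_verts tree_adj tree_verts tree_adj g"
    unfolding graph_iso_def using bij_betw_cong[of tree_verts g "f2 \<circ> inv_into tree_verts f1" tree_verts]
    by (simp add: g_def)
  then have g: "g \<in> Aut tree_verts tree_adj" unfolding Aut_def by (simp add: g_def)
  have f1b: "bij_betw f1 tree_verts tree_verts" using f1(1) unfolding graph_iso_def by blast
  have gf: "g (f1 v) = f2 v" if "v \<in> tree_verts" for v
    using that bij_betwE[OF f1b] bij_betw_inv_into_left[OF f1b] unfolding g_def by simp
  have img: "g ` f1 ` e = f2 ` e" if "e \<in> copy []" for e
  proof -
    have "e \<subseteq> tree_verts"
      using that E0D valid.simps(1) unfolding copy_def tree_verts_def by blast
    then show ?thesis using gf unfolding image_image by (intro image_cong) auto
  qed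
  have "(\<lambda>e. g ` e) ` (\<lambda>e. f1 ` e) ` copy [] = (\<lambda>e. f2 ` e) ` copy []"
    unfolding image_image[of "\<lambda>e. g ` e"] by (intro image_cong refl img)
  then have "(\<lambda>e. g ` e) ` C1 = C2" unfolding f1(2) f2(2) .
  with g show "\<exists>g\<in>Aut tree_verts tree_adj. (\<lambda>e. g ` e) ` C1 = C2" by blast
qed

end

theorem theorem3p5:
  fixes V0 :: "'a set" and E0 :: "'a \<Rightarrow> 'a \<Rightarrow> bool"
    and H :: "('a \<Rightarrow> 'a) set"
    and J :: "'j set" and Q :: "'j \<Rightarrow> 'a set"
    and K :: "'k set" and R :: "'k \<Rightarrow> 'a set"
    and \<mu> :: "'k \<Rightarrow> 'j \<Rightarrow> enat"
  assumes "simple_graph V0 E0" and "countable V0" and "biconnected V0 E0"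
    and "aut_subgroup H V0 E0"
    and "bij_betw Q J (orbits H V0)"
    and "\<forall>k\<in>K. R k \<noteq> {}"
    and "\<forall>k\<in>K. \<forall>k'\<in>K. k \<noteq> k' \<longrightarrow> R k \<inter> R k' = {}"
    and "(\<Union>k\<in>K. R k) = V0"
    and "\<forall>j\<in>J. \<exists>k\<in>K. Q j \<subseteq> R k"
    and "\<forall>k\<in>K. \<forall>j\<in>J. \<mu> k j > 0 \<longleftrightarrow> Q j \<subseteq> R k"
    and "\<exists>k\<in>K. \<exists>F. finite F \<and> F \<subseteq> J \<and> (\<Sum>j\<in>F. \<mu> k j) \<ge> 2"
  shows "(\<exists>(V :: nat set) E \<sigma>. realizes V0 E0 J Q K \<mu> V E \<sigma>) \<and>
         (\<forall>(V1 :: 'b set) E1 \<sigma>1 (V2 :: 'c set) E2 \<sigma>2.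
            realizes V0 E0 J Q K \<mu> V1 E1 \<sigma>1 \<longrightarrow> realizes V0 E0 J Q K \<mu> V2 E2 \<sigma>2 \<longrightarrow>
            (\<exists>f. graph_iso V1 E1 V2 E2 f))"
proof -
  interpret biconnected_action V0 E0 H
    using assms(1-4) by unfold_locales
  \<comment> \<open>The class of a vertex and, next, the index of its orbit translate
    \<open>\<mu>\<close> into a function of two vertices.\<close>
  define \<kappa> where "\<kappa> x = (SOME k. k \<in> K \<and> x \<in> R k)" for x
  define \<iota> where "\<iota> x = (SOME j. j \<in> J \<and> Q j = orb x)" for x
  have \<kappa>: "\<kappa> x \<in> K \<and> x \<in> R (\<kappa> x)" if "x \<in> V0" for x
    unfolding \<kappa>_def using assms(8) that by (intro someI_ex[of "\<lambda>k. k \<in> K \<and> x \<in> R k"]) blast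
  have \<kappa>_eq: "\<kappa> x = k" if "k \<in> K" "x \<in> R k" for x k
  proof -
    have "x \<in> V0" using assms(8) that by blast
    with \<kappa> that assms(7) show ?thesis by blast
  qed
  have orbits: "orbits H V0 = orb ` V0" unfolding orbits_def orb_def by blast
  have QJ: "Q ` J = orb ` V0" "inj_on Q J"
    using assms(5) unfolding orbits bij_betw_def by auto
  have \<iota>: "\<iota> x \<in> J \<and> Q (\<iota> x) = orb x" if "x \<in> V0" for x
  proof -
    have "orb x \<in> Q ` J" using QJ(1) that by blast
    then have "\<exists>j. j \<in> J \<and> Q j = orb x" by blast
    then show ?thesis unfolding \<iota>_def by (rule someI_ex)
  qed
  have \<iota>_orb: "\<iota> y = \<iota> x" if "y \<in> orb x" for x y
    unfolding \<iota>_def orb_eq[OF that] ..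
  have ex_\<iota>: "\<exists>a\<in>V0. \<iota> a = j \<and> Q j = orb a" if j: "j \<in> J" for j
  proof -
    have "Q j \<in> orb ` V0" using QJ(1) j by blast
    then obtain a where a: "a \<in> V0" "Q j = orb a" by blast
    with \<iota>[of a] j have "\<iota> a = j" using QJ(2) by (simp add: inj_on_def)
    with a show ?thesis by blast
  qed
  have pos: "\<mu> k j > 0 \<longleftrightarrow> Q j \<subseteq> R k" if "k \<in> K" "j \<in> J" for k j
    using assms(10) that by blast
  have \<kappa>_orb: "orb x \<subseteq> R (\<kappa> x)" if x: "x \<in> V0" for x
  proof -
    obtain k where k: "k \<in> K" "orb x \<subseteq> R k" using assms(9) \<iota>[OF x] by metis
    with \<kappa>_eq[of k x] orb_self show ?thesis by blast
  qed
  interpret lobe_pattern V0 E0 H "\<lambda>x a. \<mu> (\<kappa> x) (\<iota> a)"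
  proof unfold_locales
    fix h x a assume h: "h \<in> H" and x: "x \<in> V0"
    then have o: "h x \<in> orb x" unfolding orb_def by blast
    have "\<kappa> (h x) = \<kappa> x" using \<kappa>_eq[of "\<kappa> x" "h x"] \<kappa>[OF x] \<kappa>_orb[OF x] o by blast
    then show "\<mu> (\<kappa> (h x)) (\<iota> a) = \<mu> (\<kappa> x) (\<iota> a)" by simp
    show "\<mu> (\<kappa> a) (\<iota> (h x)) = \<mu> (\<kappa> a) (\<iota> x)" using \<iota>_orb[OF o] by simp
  next
    fix x assume x: "x \<in> V0"
    then show "\<mu> (\<kappa> x) (\<iota> x) > 0" using pos \<kappa> \<iota> \<kappa>_orb by simp
  next
    fix x a b assume xa: "x \<in> V0" "a \<in> V0" "\<mu> (\<kappa> x) (\<iota> a) > 0"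
    then have "a \<in> R (\<kappa> x)" using pos[of "\<kappa> x" "\<iota> a"] \<kappa> \<iota>[of a] orb_self by blast
    then have "\<kappa> a = \<kappa> x" using \<kappa>_eq \<kappa> xa(1) by blast
    then show "\<mu> (\<kappa> a) (\<iota> b) = \<mu> (\<kappa> x) (\<iota> b)" by simp
  qed
  have "connectivity_one tree_verts tree_adj"
  proof -
    obtain k F where k: "k \<in> K" and F: "finite F" "F \<subseteq> J" "(\<Sum>j\<in>F. \<mu> k j) \<ge> 2"
      using assms(11) by blast
    obtain x where x: "x \<in> R k" using assms(6) k by blast
    then have xV: "x \<in> V0" "\<kappa> x = k" using assms(8) k \<kappa>_eq by auto
    \<comment> \<open>With the reserved slot alone, \<open>\<mu> k\<close> would vanish off
      \<open>\<iota> x\<close> and be at most 1 there, against a partial sum of at least 2.\<close>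
    have "\<exists>s\<in>slots x. s \<noteq> (rep x, 0)"
    proof (rule ccontr)
      assume none: "\<not> (\<exists>s\<in>slots x. s \<noteq> (rep x, 0))"
      have rep_\<iota>: "\<iota> (rep a) = \<iota> a" for a using \<iota>_orb rep_orb by simp
      have slot: "rep a = rep x \<and> n = 0" if "a \<in> V0" "enat n < \<mu> k (\<iota> a)" for a n
      proof -
        have "(rep a, n) \<in> slots x" using that xV rep_\<iota> by (simp add: slots_def)
        with none show ?thesis by auto
      qed
      have zero: "\<mu> k j = 0" if j: "j \<in> J" "j \<noteq> \<iota> x" for j
      proof (rule ccontr)
        assume "\<mu> k j \<noteq> 0"
        then have "enat 0 < \<mu> k j" by (simp add: zero_enat_def[symmetric])
        moreover obtain a where a: "a \<in> V0" "\<iota> a = j" using ex_\<iota>[OF j(1)] by blast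
        ultimately have "rep a = rep x" using slot by blast
        with a j(2) rep_\<iota> show False by metis
      qed
      have "\<not> enat 1 < \<mu> k (\<iota> x)" using slot[OF xV(1), of 1] by auto
      then have one: "\<mu> k (\<iota> x) \<le> 1" by (simp add: one_enat_def)
      have "(\<Sum>j\<in>F. \<mu> k j) = (\<Sum>j\<in>F \<inter> {\<iota> x}. \<mu> k j)"
        using F zero by (intro sum.mono_neutral_right) auto
      also have "\<dots> \<le> 1" using one by (cases "\<iota> x \<in> F") auto
      finally show False using F(3) by (auto simp: one_enat_def numeral_eq_enat dest: order_trans)
    qed
    then show ?thesis using tree_connectivity_one[OF xV(1)] by (metis surj_pair)
  qed
  moreover have "\<exists>k\<in>K. \<forall>j\<in>J. \<mu> k j = ecard {C \<in> lobes tree_adj. v \<in> tree_iso C ` Q j}"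
    if v: "v \<in> tree_verts" for v
  proof -
    obtain L x where L: "valid L" "x \<in> V0" "v = pos L x" using v unfolding tree_verts_def by blast
    have "\<mu> (\<kappa> x) j = ecard {C \<in> lobes tree_adj. v \<in> tree_iso C ` Q j}" if "j \<in> J" for j
      using ex_\<iota>[OF that] tree_count[OF L(1,2)] L(3) by auto
    with \<kappa>[OF L(2)] show ?thesis by blast
  qed
  ultimately have existence: "realizes V0 E0 J Q K \<mu> tree_verts tree_adj tree_iso"
    using tree_lobe_graph tree_lobe_transitive
    unfolding realizes_def lobe_graph_def lobe_graph_axioms_def by blast
  have from_tree: "\<exists>f. graph_iso tree_verts tree_adj V E f" if re: "realizes V0 E0 J Q K \<mu> V E \<sigma>"
    for V :: "'v set" and E \<sigma>
  proof -
    have iso: "graph_iso V0 E0 (lobe_verts C) (lobe_adj C) (\<sigma> C)" if "C \<in> lobes E" for C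
      using re that unfolding realizes_def by blast
    have sg: "simple_graph V E" and c1: "connectivity_one V E" using re unfolding realizes_def by auto
    interpret G: lobe_graph V0 E0 H "\<lambda>x a. \<mu> (\<kappa> x) (\<iota> a)" V E \<sigma>
    proof unfold_locales
      show "simple_graph V E" "countable V" "connected_in V E"
        using re unfolding realizes_def connectivity_one_def by auto
      fix C assume C: "C \<in> lobes E"
      then show "graph_iso V0 E0 (lobe_verts C) (lobe_adj C) (\<sigma> C)" by (rule iso)
      fix x a assume x: "x \<in> V0" and a: "a \<in> V0"
      have "\<sigma> C x \<in> lobe_verts C" using iso[OF C] x unfolding graph_iso_def by (meson bij_betwE)
      then have "\<sigma> C x \<in> V" using lobe_verts_subset[OF sg C] by blast
      then obtain k where k: "k \<in> K"
        "\<And>j. j \<in> J \<Longrightarrow> \<mu> k j = ecard {C' \<in> lobes E. \<sigma> C x \<in> \<sigma> C' ` Q j}"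
        using re unfolding realizes_def by blast
      \<comment> \<open>\<open>C\<close> itself is counted, so the number is positive, and
        \<open>k\<close>, so far only known to exist, is the class of \<open>x\<close>.\<close>
      have "C \<in> {C' \<in> lobes E. \<sigma> C x \<in> \<sigma> C' ` Q (\<iota> x)}" using C \<iota>[OF x] orb_self by auto
      then have "ecard {C' \<in> lobes E. \<sigma> C x \<in> \<sigma> C' ` Q (\<iota> x)} > 0"
        unfolding ecard_def by (auto simp: zero_enat_def card_gt_0_iff)
      then have "\<mu> k (\<iota> x) > 0" using k(2) \<iota>[OF x] by simp
      then have "x \<in> R k" using pos k(1) \<iota>[OF x] orb_self by blast
      then have "k = \<kappa> x" using \<kappa>_eq k(1) by blast
      then show "ecard {C' \<in> lobes E. \<sigma> C x \<in> \<sigma> C' ` orb a} = \<mu> (\<kappa> x) (\<iota> a)"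
        using k(2)[of "\<iota> a"] \<iota>[OF a] by simp
    qed
    \<comment> \<open>An edge supplies a lobe to serve as root.\<close>
    obtain u w where "E u w" using connectivity_one_edge[OF c1] .
    then obtain C where "C \<in> lobes E" using G.ex_lobe by blast
    then obtain f where "graph_iso tree_verts tree_adj V E f" by (rule G.ex_iso_from_tree)
    then show ?thesis by blast
  qed
  have "\<exists>f. graph_iso V1 E1 V2 E2 f"
    if "realizes V0 E0 J Q K \<mu> V1 E1 \<sigma>1" "realizes V0 E0 J Q K \<mu> V2 E2 \<sigma>2"
    for V1 :: "'b set" and E1 \<sigma>1 and V2 :: "'c set" and E2 \<sigma>2
    using from_tree[OF that(1)] from_tree[OF that(2)] graph_iso_comp graph_iso_inv by metis
  with existence show ?thesis by blast
qed

end
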